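(* Let $n \geq 2$ be an integer, let $M(n)=R\big(A_{3}(R(K_n^*,L_3)),3\big)$ and let $\gamma=\omega^4 \cdot M(n)+1$. Then $\gamma \rightarrow_{cl} (\omega \cdot n+1,3)^2$.
   Context: Complete directed graph $K_m^*$: $m$ vertices, edges all ordered pairs $(a,b)$ of distinct vertices. $R(K_n^*,L_3)$ is the least positive integer $m$ such that for every coloring of the edges of $K_m^*$ with red and blue, either there are $n$ vertices all of whose ordered pairs are red, or there are three distinct vertices $a,b,c$ with the edges $(a,b),(b,c),(a,c)$ all blue (a blue transitive tournament on $3$ vertices). For an integer $k\ge 3$, $A_3(k)$ is the least positive integer $m$ such that for every coloring $c$ of the edges of $K_m^*$ with colors $\{0,1,2\}$ there is a set $S$ of $k$ vertices such that for every $x\in S$ some color $i_x$ satisfies $c((y,x))\ne i_x$ for all $y\in S\setminus\{x\}$. For a positive integer $N$, $R(N,3)$ is the classical finite Ramsey number: the least $m$ such that every red/blue coloring of the edges of the complete graph on $m$ vertices has a red complete subgraph on $N$ vertices or a blue triangle. Ordinals carry the order topology; $X\subseteq\alpha$ is a closed copy of $\beta$ if some map $X\to\beta$ is both an order-isomorphism and a homeomorphism (subspace topology on $X$). $[X]^2$ is the set of two-element subsets of $X$ and $3=\{0,1,2\}$. $\gamma \rightarrow_{cl} (\alpha,\beta)^2$ means: for every $\mathfrak{c}:[\gamma]^2\to\{0,1\}$ there is $X\subseteq\gamma$ which is a closed copy of $\alpha$ with $\mathfrak{c}\equiv0$ on $[X]^2$ or a closed copy of $\beta$ with $\mathfrak{c}\equiv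 1$ on $[X]^2$. *)

theory Defs
  imports "HOL-Analysis.Abstract_Topology" "HOL-Library.Ramsey"
begin

text \<open>Directed and classical Ramsey numbers. In all two-colourings, red is \<open>0\<close> and blue is \<open>1\<close>.\<close>

definition complete_digraph_edges :: "nat \<Rightarrow> (nat \<times> nat) set" where
  "complete_digraph_edges m = {(a, b). a < m \<and> b < m \<and> a \<noteq> b}"

definition ramsey_K_L3 :: "nat \<Rightarrow> nat" where
  "ramsey_K_L3 n =
    (LEAST m. 0 < m \<and>
      (\<forall>c \<in> complete_digraph_edges m \<rightarrow> {0, 1::nat}.
        (\<exists>S \<in> nsets {..<m} n. \<forall>a \<in> S. \<forall>b \<in> S. a \<noteq> b \<longrightarrow> c (a, b) = 0) \<or>
        (\<exists>u \<in> {..<m}. \<exists>v \<in> {..<m}. \<exists>w \<in> {..<m}. u \<noteq> v \<and> v \<noteq> w \<and> u \<noteq> w \<and>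
          c (u, v) = 1 \<and> c (v, w) = 1 \<and> c (u, w) = 1)))"

definition A3 :: "nat \<Rightarrow> nat" where
  "A3 k =
    (LEAST m. 0 < m \<and>
      (\<forall>c \<in> complete_digraph_edges m \<rightarrow> {0, 1, 2::nat}.
        \<exists>S \<in> nsets {..<m} k. \<forall>x \<in> S. \<exists>i \<in> {0, 1, 2}. \<forall>y \<in> S - {x}. c (y, x) \<noteq> i))"

definition ramsey_number :: "nat \<Rightarrow> nat \<Rightarrow> nat" where
  "ramsey_number k l = (LEAST m. partn_lst {..<m} [k, l] 2)"

text \<open>
  An ordinal is represented by a well-order \<open>r\<close> of that order type, the set of its elements
  being \<open>Field r\<close>; \<open>\<omega>\<close> is \<^const>\<open>natLeq\<close> and a finite ordinal \<open>n\<close> is \<open>natLeq_on n\<close>.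
\<close>

definition osum :: "'a rel \<Rightarrow> 'b rel \<Rightarrow> ('a + 'b) rel" (infixl \<open>+\<^sub>o\<close> 65) where
  "r +\<^sub>o s = map_prod Inl Inl ` r \<union> map_prod Inr Inr ` s \<union> (Inl ` Field r) \<times> (Inr ` Field s)"

text \<open>
  In the ordinal product \<open>\<alpha> \<cdot> \<beta>\<close>, that is \<open>\<beta>\<close> copies of \<open>\<alpha>\<close>, the coordinate in \<open>\<beta>\<close> is the most
  significant one; it is placed first, so the elements are pairs in \<open>\<beta> \<times> \<alpha>\<close>.
\<close>

definition oprod :: "'a rel \<Rightarrow> 'b rel \<Rightarrow> ('b \<times> 'a) rel" (infixl \<open>*\<^sub>o\<close> 70) where
  "r *\<^sub>o s = Restr ((s - Id) <*lex*> r) (Field s \<times> Field r)"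

lemma Field_osum: "Field (r +\<^sub>o s) = Field r <+> Field s"
  unfolding osum_def Field_def Plus_def by force

lemma Field_oprod:
  assumes "Refl r"
  shows "Field (r *\<^sub>o s) = Field s \<times> Field r"
proof (intro subset_antisym subsetI)
  fix p assume "p \<in> Field (r *\<^sub>o s)"
  then obtain q where "(p, q) \<in> r *\<^sub>o s \<or> (q, p) \<in> r *\<^sub>o s"
    by (auto simp: Field_def)
  then show "p \<in> Field s \<times> Field r"
    by (auto simp: oprod_def)
next
  fix p assume "p \<in> Field s \<times> Field r"
  then have "(p, p) \<in> r *\<^sub>o s"
    using assms by (auto simp: oprod_def refl_on_def)
  then show "p \<in> Field (r *\<^sub>o s)"
    by (rule FieldI1)
qed

lemma Well_order_osum:
  assumes r: "Well_order r" and s: "Well_order s"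
  shows "Well_order (r +\<^sub>o s)"
proof -
  have ord: "Refl r" "trans r" "antisym r" "Total r" "Refl s" "trans s" "antisym s" "Total s"
    and wf: "wf (r - Id)" "wf (s - Id)"
    using assms by (auto simp: order_on_defs)
  have "Refl (r +\<^sub>o s)"
    using ord unfolding Field_osum refl_on_def by (auto simp: osum_def)
  moreover have "trans (r +\<^sub>o s)"
    by (rule transI)
      (use ord(2,6) in \<open>auto simp: osum_def dest: transD intro: FieldI1 FieldI2\<close>)
  moreover have "antisym (r +\<^sub>o s)"
    using ord unfolding antisym_def by (fastforce simp: osum_def)
  moreover have "Total (r +\<^sub>o s)"
    using ord unfolding Field_osum total_on_def by (force simp: osum_def)
  moreover have "wf (r +\<^sub>o s - Id)"
  proof (rule wfI_min)
    fix x :: "'a + 'b" and Q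
    assume x: "x \<in> Q"
    show "\<exists>z\<in>Q. \<forall>y. (y, z) \<in> r +\<^sub>o s - Id \<longrightarrow> y \<notin> Q"
    proof (cases "\<exists>a. Inl a \<in> Q")
      case True
      then obtain z where z: "z \<in> Inl -` Q" "\<And>y. (y, z) \<in> r - Id \<Longrightarrow> y \<notin> Inl -` Q"
        using wf(1) by (metis wfE_min vimageI)
      then show ?thesis
        by (intro bexI[of _ "Inl z"]) (auto simp: osum_def)
    next
      case False
      with x obtain b where "Inr b \<in> Q"
        by (cases x) auto
      then obtain z where "z \<in> Inr -` Q" "\<And>y. (y, z) \<in> s - Id \<Longrightarrow> y \<notin> Inr -` Q"
        using wf(2) by (metis wfE_min vimageI)
      with False show ?thesis
        by (intro bexI[of _ "Inr z"]) (auto simp: osum_def)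
    qed
  qed
  ultimately show ?thesis
    by (auto simp: order_on_defs intro: FieldI1 FieldI2)
qed

lemma Well_order_oprod:
  assumes r: "Well_order r" and s: "Well_order s"
  shows "Well_order (r *\<^sub>o s)"
proof -
  have ord: "Refl r" "trans r" "antisym r" "Total r" "Refl s" "trans s" "antisym s" "Total s"
    and wf: "wf (r - Id)" "wf (s - Id)"
    using assms by (auto simp: order_on_defs)
  note F = Field_oprod[OF ord(1)]
  have "Refl (r *\<^sub>o s)"
    using ord unfolding F refl_on_def by (auto simp: oprod_def)
  moreover have "trans (r *\<^sub>o s)"
    by (rule transI)
      (use ord(2,6,7) in \<open>auto simp: oprod_def dest: transD antisymD\<close>)
  moreover have "antisym (r *\<^sub>o s)"
    using ord unfolding antisym_def by (fastforce simp: oprod_def)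
  moreover have "Total (r *\<^sub>o s)"
    using ord unfolding F total_on_def by (auto simp: oprod_def)
  moreover have "wf (r *\<^sub>o s - Id)"
    by (rule wf_subset[OF wf_lex_prod[OF wf(2,1)]]) (auto simp: oprod_def)
  ultimately show ?thesis
    by (auto simp: order_on_defs intro: FieldI1 FieldI2)
qed

abbreviation omega_pow_4 :: "(nat \<times> nat \<times> nat \<times> nat) rel" where
  "omega_pow_4 \<equiv> natLeq *\<^sub>o natLeq *\<^sub>o natLeq *\<^sub>o natLeq"

text \<open>The open rays generate the order topology; \<open>Field r\<close> itself is needed for one-point orders.\<close>

definition order_topology_on :: "'a rel \<Rightarrow> 'a topology" where
  "order_topology_on r =
    topology_generated_by ({Field r} \<union> underS r ` Field r \<union> aboveS r ` Field r)"

definition closed_copy :: "'a rel \<Rightarrow> 'a set \<Rightarrow> 'b rel \<Rightarrow> bool" where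
  "closed_copy r X s \<longleftrightarrow> X \<subseteq> Field r \<and>
    (\<exists>f. iso (Restr r X) s f \<and>
         homeomorphic_map (subtopology (order_topology_on r) X) (order_topology_on s) f)"

definition closed_partition :: "'c rel \<Rightarrow> 'a rel \<Rightarrow> 'b rel \<Rightarrow> bool"
    (\<open>_ \<rightarrow>\<^sub>c\<^sub>l '(_, _')\<^sup>2\<close> [51, 0, 0] 50) where
  "g \<rightarrow>\<^sub>c\<^sub>l (r, s)\<^sup>2 \<longleftrightarrow>
    (\<forall>c \<in> nsets (Field g) 2 \<rightarrow> {0, 1::nat}.
      \<exists>X \<subseteq> Field g.
        (closed_copy g X r \<and> (\<forall>e \<in> nsets X 2. c e = 0)) \<or>
        (closed_copy g X s \<and> (\<forall>e \<in> nsets X 2. c e = 1)))"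

end

theory Submission
  imports Defs
begin

text \<open>
  Suppose there is no blue triangle. Among the \<open>M\<close> points \<open>\<omega>\<^sup>4 \<cdot> (i + 1)\<close> choose \<open>A3 k\<close> pairwise red
  ones, where \<open>k = ramsey_K_L3 n\<close>. Below each of them lie limit points of the four ranks \<open>0, \<dots>, 3\<close>;
  a nonprincipal ultrafilter on \<open>\<nat>\<close>, iterated along the coordinates, decides for every point \<open>y\<close> and
  every rank whether \<open>y\<close> is blue to almost all points of that rank. The blue neighbourhood of \<open>y\<close> is
  red, so if \<open>y\<close> saw two ranks blue below the same point, that neighbourhood would contain a closed
  copy of \<open>\<omega> \<cdot> n + 1\<close>. Hence \<open>y\<close> sees at most one rank blue. Discard the rank that the chosen point
  sees itself; the definition of \<open>A3\<close> then yields \<open>k\<close> of the chosen points, each with a rank that none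
  of the \<open>k\<close> points sees blue. Take a sequence of points of this rank converging to each of them. After
  thinning out by Ramsey's theorem, the colour between the \<open>m\<close>-th term for \<open>x\<close> and the \<open>l\<close>-th term for
  \<open>y\<close>, \<open>m < l\<close>, depends on \<open>(x, y)\<close> only. In this directed colouring a blue transitive triangle would
  give a blue triangle, so there are \<open>n\<close> points with all pairs red; they and their sequences form a
  red closed copy of \<open>\<omega> \<cdot> n + 1\<close>.
\<close>

section \<open>Closed copies in the order topology\<close>

lemma Well_order_not_le:
  assumes "Well_order r" "x \<in> Field r" "y \<in> Field r"
  shows "(x, y) \<notin> r \<longleftrightarrow> (y, x) \<in> r - Id"
proof -
  have r: "Refl r" "antisym r" "Total r"
    using assms(1) by (auto simp: order_on_defs)
  show ?thesis
  proof
    assume "(x, y) \<notin> r"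
    moreover from this have "x \<noteq> y"
      using refl_onD[OF r(1) assms(2)] by auto
    ultimately show "(y, x) \<in> r - Id"
      using r(3) assms(2,3) by (auto simp: total_on_def)
  next
    assume "(y, x) \<in> r - Id"
    then show "(x, y) \<notin> r"
      using antisymD[OF r(2)] by auto
  qed
qed

text \<open>The inverse of a strictly increasing map is always continuous, since rays of
  \<open>s\<close> correspond to traces of rays of \<open>g\<close>. Continuity of \<open>h\<close>
  is at stake only at limits, so \<open>cont\<close> lets each \<open>j\<close> be least, an
  immediate successor, or mapped to the supremum of the earlier values.\<close>

lemma closed_copyI:
  assumes g: "Well_order g" and s: "Well_order s"
    and h: "h ` Field s \<subseteq> Field g"
    and mono: "\<And>i j. (i, j) \<in> s - Id \<Longrightarrow> (h i, h j) \<in> g - Id"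
    and cont: "\<And>j. j \<in> Field s \<Longrightarrow> (\<forall>i\<in>Field s. (j, i) \<in> s) \<or>
      (\<exists>k\<in>Field s. \<forall>i\<in>Field s. (j, i) \<in> s \<longleftrightarrow> (k, i) \<in> s - Id) \<or>
      (\<forall>z. (z, h j) \<in> g - Id \<longrightarrow> (\<exists>i. (i, j) \<in> s - Id \<and> (z, h i) \<in> g - Id))"
  shows "closed_copy g (h ` Field s) s"
proof -
  let ?X = "h ` Field s"
  define f where "f = inv_into (Field s) h"
  have ordg: "Refl g" "trans g" "antisym g" "Total g"
    and ords: "Refl s" "trans s" "antisym s" "Total s" and wfs: "wf (s - Id)"
    using g s by (auto simp: order_on_defs)
  note not_le_g = Well_order_not_le[OF g] and not_le_s = Well_order_not_le[OF s]
  have hF: "h i \<in> Field g" if "i \<in> Field s" for i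
    using h that by blast
  have le: "(h i, h j) \<in> g \<longleftrightarrow> (i, j) \<in> s" if "i \<in> Field s" "j \<in> Field s" for i j
  proof
    assume "(h i, h j) \<in> g"
    then show "(i, j) \<in> s"
      using mono[of j i] not_le_s[OF that] not_le_g[OF hF[OF that(1)] hF[OF that(2)]] by blast
  next
    assume "(i, j) \<in> s"
    then show "(h i, h j) \<in> g"
      using mono[of i j] refl_onD[OF ordg(1) hF[OF that(1)]] by (cases "i = j") auto
  qed
  have inj: "inj_on h (Field s)"
    by (rule inj_onI) (metis le ords(1,3) antisymD refl_onD)
  have fh [simp]: "f (h i) = i" if "i \<in> Field s" for i
    using inj that by (simp add: f_def)
  have hf: "h (f x) = x" "f x \<in> Field s" if "x \<in> ?X" for x
    using that by auto
  have FX: "Field (Restr g ?X) = ?X"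
    using Refl_Field_Restr2[OF ordg(1) h] .
  have iso: "iso (Restr g ?X) s f"
    unfolding iso_iff2 FX
  proof safe
    show "bij_betw f ?X (Field s)"
      by (rule bij_betw_byWitness[where f' = h]) auto
  qed (auto simp: le)
  have topg: "topspace (order_topology_on g) = Field g"
    unfolding order_topology_on_def topology_generated_by_topspace
    by (auto simp: underS_def aboveS_def Field_def)
  have tops: "topspace (order_topology_on s) = Field s"
    unfolding order_topology_on_def topology_generated_by_topspace
    by (auto simp: underS_def aboveS_def Field_def)
  let ?T = "subtopology (order_topology_on g) ?X"
  have topX: "topspace ?T = ?X"
    using h by (auto simp: topg)
  have og: "openin (order_topology_on g) U" if "U \<in> {Field g} \<union> underS g ` Field g \<union> aboveS g ` Field g" for U
    unfolding order_topology_on_def by (rule topology_generated_by_Basis[OF that])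
  have os: "openin (order_topology_on s) U" if "U \<in> {Field s} \<union> underS s ` Field s \<union> aboveS s ` Field s" for U
    unfolding order_topology_on_def by (rule topology_generated_by_Basis[OF that])
  have cf: "continuous_map ?T (order_topology_on s) f"
    unfolding order_topology_on_def[of s] continuous_on_generated_topo_iff topX
  proof (intro conjI allI impI)
    fix U assume "U \<in> {Field s} \<union> underS s ` Field s \<union> aboveS s ` Field s"
    then consider "U = Field s" | k where "k \<in> Field s" "U = underS s k" | k where "k \<in> Field s" "U = aboveS s k"
      by auto
    then show "openin ?T (f -` U \<inter> ?X)"
    proof cases
      case 1
      then have "f -` U \<inter> ?X = topspace ?T" unfolding topX by auto
      then show ?thesis using openin_topspace by metis
    next
      case 2
      then have "f -` U \<inter> ?X = underS g (h k) \<inter> ?X"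
        using inj by (auto simp: underS_def le inj_on_def)
      moreover have "openin (order_topology_on g) (underS g (h k))"
        using h 2 by (intro og) auto
      ultimately show ?thesis by (auto simp: openin_subtopology)
    next
      case 3
      then have "f -` U \<inter> ?X = aboveS g (h k) \<inter> ?X"
        using inj by (auto simp: aboveS_def le inj_on_def)
      moreover have "openin (order_topology_on g) (aboveS g (h k))"
        using h 3 by (intro og) auto
      ultimately show ?thesis by (auto simp: openin_subtopology)
    qed
  qed auto
  have least: "\<exists>j\<in>J. \<forall>i\<in>J. (j, i) \<in> s" if "J \<noteq> {}" "J \<subseteq> Field s" for J
  proof -
    obtain j where "j \<in> J" "\<And>i. (i, j) \<in> s - Id \<Longrightarrow> i \<notin> J"
      using wfE_min[OF wfs] \<open>J \<noteq> {}\<close> by (metis ex_in_conv)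
    then show ?thesis
      using not_le_s that(2) by (intro bexI[of _ j] ballI) (blast, blast)
  qed
  have ch: "continuous_map (order_topology_on s) (order_topology_on g) h"
    unfolding order_topology_on_def[of g] continuous_on_generated_topo_iff tops
  proof (intro conjI allI impI)
    fix U assume "U \<in> {Field g} \<union> underS g ` Field g \<union> aboveS g ` Field g"
    then consider "U = Field g" | z where "z \<in> Field g" "U = underS g z" | z where "z \<in> Field g" "U = aboveS g z"
      by auto
    then show "openin (order_topology_on s) (h -` U \<inter> Field s)"
    proof cases
      case 1
      then have "h -` U \<inter> Field s = Field s" using h by auto
      then show ?thesis using os by simp
    next
      case 2
      let ?J = "{j \<in> Field s. (z, h j) \<in> g}"
      show ?thesis
      proof (cases "?J = {}")
        case True
        then have "h -` U \<inter> Field s = Field s"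
          using not_le_g[OF 2(1) hF] 2(2) unfolding underS_def by blast
        then show ?thesis using os by simp
      next
        case False
        then obtain j where j: "j \<in> ?J" "\<forall>i\<in>?J. (j, i) \<in> s"
          using least[of ?J] by auto
        have "h -` U \<inter> Field s = underS s j"
        proof (intro set_eqI iffI)
          fix i assume "i \<in> h -` U \<inter> Field s"
          then have i: "i \<in> Field s" "(h i, z) \<in> g - Id" using 2 by (auto simp: underS_def)
          have "(j, i) \<notin> s"
          proof
            assume "(j, i) \<in> s"
            then have "(z, h i) \<in> g"
              using j(1) le[of j i] i(1) ordg(2) by (blast dest: transD)
            then show False
              using not_le_g[OF 2(1) hF[OF i(1)]] i(2) by blast
          qed
          then show "i \<in> underS s j"
            using not_le_s[of j i] j(1) i(1) by (auto simp: underS_def)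
        next
          fix i assume "i \<in> underS s j"
          then have i: "i \<in> Field s" "(i, j) \<in> s - Id" by (auto simp: underS_def Field_def)
          then have "(j, i) \<notin> s"
            using not_le_s[of j i] j(1) by blast
          then have "(z, h i) \<notin> g"
            using j(2) i(1) by blast
          then show "i \<in> h -` U \<inter> Field s"
            using not_le_g[OF 2(1) hF[OF i(1)]] i(1) 2(2) by (auto simp: underS_def)
        qed
        then show ?thesis using os j by auto
      qed
    next
      case 3
      let ?J = "{j \<in> Field s. (z, h j) \<in> g - Id}"
      have J: "h -` U \<inter> Field s = ?J"
        using 3 by (auto simp: aboveS_def)
      show ?thesis
      proof (cases "?J = {}")
        case True
        show ?thesis unfolding J True by simp
      next
        case False
        then obtain j where j: "j \<in> Field s" "(z, h j) \<in> g - Id" "\<forall>i\<in>?J. (j, i) \<in> s"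
          using least[of ?J] by auto
        have eq: "?J = {i \<in> Field s. (j, i) \<in> s}"
        proof (intro set_eqI iffI)
          fix i assume "i \<in> {i \<in> Field s. (j, i) \<in> s}"
          then have i: "i \<in> Field s" "(h j, h i) \<in> g" using j(1) le by auto
          then have "(z, h i) \<in> g" using j(2) ordg(2) by (blast dest: transD)
          moreover have "z \<noteq> h i" using i j(2) ordg(3) by (auto dest: antisymD)
          ultimately show "i \<in> ?J" using i by auto
        qed (use j(3) in blast)
        \<comment> \<open>Minimality of \<open>j\<close> rules out the supremum alternative of
          \<open>cont\<close>: an earlier \<open>h i\<close> would already exceed \<open>z\<close>.
          In the other two cases the final segment from \<open>j\<close> on is the whole field or an
          open ray.\<close>
        have "\<not> (\<exists>i. (i, j) \<in> s - Id \<and> (z, h i) \<in> g - Id)"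
          using j(1,3) not_le_s[of j] by (blast intro: FieldI1)
        with cont[OF j(1)] j(2) consider "\<forall>i\<in>Field s. (j, i) \<in> s"
          | k where "k \<in> Field s" "\<forall>i\<in>Field s. (j, i) \<in> s \<longleftrightarrow> (k, i) \<in> s - Id"
          by blast
        then show ?thesis
        proof cases
          case 1
          then have "?J = Field s" unfolding eq by auto
          then show ?thesis unfolding J using os by simp
        next
          case 2
          then have "?J = aboveS s k"
            unfolding eq aboveS_def by (auto intro: FieldI2)
          then show ?thesis unfolding J using os 2(1) by simp
        qed
      qed
    qed
  qed (use h in auto)
  have "homeomorphic_maps ?T (order_topology_on s) f h"
    unfolding homeomorphic_maps_def topX tops
    using cf ch hf fh by (auto simp: continuous_map_in_subtopology tops)
  then show ?thesis
    unfolding closed_copy_def homeomorphic_map_maps using iso h by blast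
qed

section \<open>Membership and fields of sums and products of orders\<close>

lemma in_osum_simps [simp]:
  "(Inl a, Inl a') \<in> r +\<^sub>o s \<longleftrightarrow> (a, a') \<in> r"
  "(Inr b, Inr b') \<in> r +\<^sub>o s \<longleftrightarrow> (b, b') \<in> s"
  "(Inl a, Inr b) \<in> r +\<^sub>o s \<longleftrightarrow> a \<in> Field r \<and> b \<in> Field s"
  "(Inr b, Inl a) \<notin> r +\<^sub>o s"
  by (auto simp: osum_def)

lemma in_oprod_iff [simp]:
  "((a, b), (a', b')) \<in> r *\<^sub>o s \<longleftrightarrow> a \<in> Field s \<and> a' \<in> Field s \<and> b \<in> Field r \<and> b' \<in> Field r \<and>
    ((a, a') \<in> s - Id \<or> a = a' \<and> (b, b') \<in> r)"
  by (auto simp: oprod_def)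

lemma in_natLeq_iff [simp]: "(a, b) \<in> natLeq \<longleftrightarrow> a \<le> b"
  by (simp add: natLeq_def)

lemma Field_oprod_natLeq: "Field (natLeq *\<^sub>o s) = Field s \<times> UNIV"
  unfolding Field_oprod[OF natLeq_Refl] Field_natLeq ..

lemma Refl_oprod:
  assumes "Refl r" "Refl s"
  shows "Refl (r *\<^sub>o s)"
  unfolding Field_oprod[OF assms(1)] using assms by (auto simp: refl_on_def)

lemma Field_omega_pow_4: "Field omega_pow_4 = UNIV"
  unfolding Field_oprod[OF Refl_oprod[OF Refl_oprod[OF natLeq_Refl natLeq_Refl] natLeq_Refl]]
    Field_oprod[OF Refl_oprod[OF natLeq_Refl natLeq_Refl]] Field_oprod_natLeq Field_natLeq
  by simp

text \<open>In a finite order every index is least or a successor, so no limit condition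
  arises.\<close>

lemma closed_copy_natLeq_on_3_ordered:
  assumes g: "Well_order g" and "(x, y) \<in> g - Id" "(y, z) \<in> g - Id"
  shows "closed_copy g {x, y, z} (natLeq_on 3)"
proof -
  define h where "h i = (if i = 0 then x else if i = 1 then y else z)" for i :: nat
  have F: "Field (natLeq_on 3) = {0, 1, 2}"
    by (auto simp: Field_natLeq_on)
  have xz: "(x, z) \<in> g - Id"
    using assms by (auto simp: order_on_defs dest: transD antisymD)
  have "closed_copy g (h ` Field (natLeq_on 3)) (natLeq_on 3)"
  proof (rule closed_copyI[OF g natLeq_on_Well_order])
    show "h ` Field (natLeq_on 3) \<subseteq> Field g"
      using assms by (auto simp: h_def intro: FieldI1 FieldI2)
    show "(h i, h j) \<in> g - Id" if "(i, j) \<in> natLeq_on 3 - Id" for i j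
    proof -
      have "i = 0 \<and> j = 1 \<or> i = 1 \<and> j = 2 \<or> i = 0 \<and> j = 2"
        using that by auto
      then show ?thesis
        using assms xz by (auto simp: h_def)
    qed
    fix j assume "j \<in> Field (natLeq_on 3)"
    then have "j = 0 \<or> (\<exists>k\<in>Field (natLeq_on 3). \<forall>i\<in>Field (natLeq_on 3).
        (j, i) \<in> natLeq_on 3 \<longleftrightarrow> (k, i) \<in> natLeq_on 3 - Id)"
      by (cases j) (auto simp: Field_natLeq_on intro!: exI[of _ "j - 1"])
    then show "(\<forall>i\<in>Field (natLeq_on 3). (j, i) \<in> natLeq_on 3) \<or>
        (\<exists>k\<in>Field (natLeq_on 3). \<forall>i\<in>Field (natLeq_on 3).
          (j, i) \<in> natLeq_on 3 \<longleftrightarrow> (k, i) \<in> natLeq_on 3 - Id) \<or>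
        (\<forall>z. (z, h j) \<in> g - Id \<longrightarrow> (\<exists>i. (i, j) \<in> natLeq_on 3 - Id \<and> (z, h i) \<in> g - Id))"
      by (auto simp: Field_natLeq_on)
  qed
  then show ?thesis
    by (simp add: F h_def insert_commute)
qed

text \<open>Sorting the points reduces this to the ordered case. Hence every blue triangle is a blue
  closed copy of \<open>3\<close>.\<close>

lemma closed_copy_natLeq_on_3:
  assumes g: "Well_order g" and F: "x \<in> Field g" "y \<in> Field g" "z \<in> Field g"
    and ne: "x \<noteq> y" "y \<noteq> z" "x \<noteq> z"
  shows "closed_copy g {x, y, z} (natLeq_on 3)"
proof -
  have lin: "(u, v) \<in> g - Id \<or> (v, u) \<in> g - Id" if "u \<in> Field g" "v \<in> Field g" "u \<noteq> v" for u v
    using Well_order_not_le[OF g that(1,2)] that(3) by auto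
  have perm: "closed_copy g {x, y, z} (natLeq_on 3)"
    if "(u, v) \<in> g - Id" "(v, w) \<in> g - Id" "{u, v, w} = {x, y, z}" for u v w
    using closed_copy_natLeq_on_3_ordered[OF g that(1,2)] that(3) by simp
  consider "(x, y) \<in> g - Id" "(y, z) \<in> g - Id" | "(x, z) \<in> g - Id" "(z, y) \<in> g - Id"
    | "(y, x) \<in> g - Id" "(x, z) \<in> g - Id" | "(y, z) \<in> g - Id" "(z, x) \<in> g - Id"
    | "(z, x) \<in> g - Id" "(x, y) \<in> g - Id" | "(z, y) \<in> g - Id" "(y, x) \<in> g - Id"
    using lin[OF F(1,2) ne(1)] lin[OF F(2,3) ne(2)] lin[OF F(1,3) ne(3)] by argo
  then show ?thesis
    by cases (erule (1) perm, simp add: insert_commute)+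
qed

text \<open>The blocks \<open>b i\<close> are stacked, each followed by its limit
  \<open>x i\<close>. Only a subset of the points is used: the first position after block
  \<open>i\<close> is taken by \<open>x i\<close>, so \<open>b (Suc i) 0\<close> is left
  out.\<close>

lemma closed_copy_omega_times_plus_one:
  fixes g :: "'a rel" and x :: "nat \<Rightarrow> 'a" and b :: "nat \<Rightarrow> nat \<Rightarrow> 'a"
  assumes g: "Well_order g" and n: "0 < n"
    and bb: "\<And>i t. i < n \<Longrightarrow> (b i t, b i (Suc t)) \<in> g - Id"
    and bx: "\<And>i t. i < n \<Longrightarrow> (b i t, x i) \<in> g - Id"
    and xb: "\<And>i. Suc i < n \<Longrightarrow> (x i, b (Suc i) 0) \<in> g - Id"
    and lim: "\<And>i z. i < n \<Longrightarrow> (z, x i) \<in> g - Id \<Longrightarrow> \<exists>t. (z, b i t) \<in> g - Id"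
  shows "\<exists>X \<subseteq> {x i |i. i < n} \<union> {b i t |i t. i < n}.
    closed_copy g X (natLeq *\<^sub>o natLeq_on n +\<^sub>o natLeq_on 1)"
proof -
  define N U where "N = natLeq_on n" and "U = natLeq_on 1"
  have N: "Field N = {..<n}" "\<And>i j. (i, j) \<in> N \<longleftrightarrow> i < n \<and> j < n \<and> i \<le> j" "Well_order N"
    unfolding N_def by (auto simp: Field_natLeq_on natLeq_on_well_order_on)
  have U: "Field U = {0}" "\<And>i j. (i, j) \<in> U \<longleftrightarrow> i = 0 \<and> j = 0" "Well_order U"
    unfolding U_def Field_natLeq_on using natLeq_on_well_order_on[of 1] by auto
  note simps = N(1,2) U(1,2) Field_oprod_natLeq Field_natLeq
  let ?s = "natLeq *\<^sub>o N +\<^sub>o U"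
  \<comment> \<open>For \<open>0 < i\<close> the index \<open>(i, 0)\<close> stands for
    \<open>\<omega> \<cdot> i\<close>, a limit, and receives the limit point of the preceding block;
    the top element receives the last limit point.\<close>
  define h where "h = (\<lambda>p :: (nat \<times> nat) + nat. case p of
      Inl (i, t) \<Rightarrow> if t = 0 \<and> 0 < i then x (i - 1) else b i t
    | Inr _ \<Rightarrow> x (n - 1))"
  have trg: "(u, w) \<in> g - Id" if "(u, v) \<in> g - Id" "(v, w) \<in> g - Id" for u v w
    using g that by (auto simp: order_on_defs dest: transD antisymD)
  have b_less: "(b i t, b i t') \<in> g - Id" if "i < n" "t < t'" for i t t'
    using that(2)
  proof (induction t' rule: less_Suc_induct)
    case (1 t) show ?case using bb that(1) by blast
  next
    case (2 t u v) then show ?case using trg by blast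
  qed
  have x_less: "(x i, x j) \<in> g - Id" if "i < j" "j < n" for i j
    using that
  proof (induction j rule: less_Suc_induct)
    case (1 i) then show ?case using trg[OF xb bx] by blast
  next
    case (2 i j k) then show ?case using trg by (meson order.strict_trans)
  qed
  have x_le_b: "(x i, b j t) \<in> g - Id" if "i < j" "j < n" for i j t
  proof -
    have j: "(x (j - 1), b j 0) \<in> g - Id"
      using xb[of "j - 1"] that by simp
    then have "(x i, b j 0) \<in> g - Id"
      using trg[OF x_less[of i "j - 1"] j] that by (cases "i = j - 1") auto
    then show ?thesis
      using trg[OF _ b_less[of j 0 t]] that by (cases "t = 0") auto
  qed
  have F: "Field ?s = Inl ` ({..<n} \<times> UNIV) \<union> {Inr 0}"
    unfolding Field_osum by (auto simp: simps)
  have ws: "Well_order ?s"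
    by (intro Well_order_osum Well_order_oprod N(3) U(3) natLeq_Well_order)
  have "closed_copy g (h ` Field ?s) ?s"
  proof (rule closed_copyI[OF g ws])
    show "h ` Field ?s \<subseteq> Field g"
    proof (rule image_subsetI)
      fix p assume "p \<in> Field ?s"
      then consider "p = Inr 0" | i t where "p = Inl (i, t)" "i < n"
        unfolding F by auto
      then show "h p \<in> Field g"
      proof cases
        case 1
        then show ?thesis
          using bx[of "n - 1" 0] n by (auto simp: h_def intro: FieldI2)
      next
        case (2 i t)
        then show ?thesis
          using FieldI1[of "b i t" "x i" g] FieldI2[of "b (i - 1) t" "x (i - 1)" g]
            bx[of i t] bx[of "i - 1" t] by (auto simp: h_def)
      qed
    qed
    show "(h p, h q) \<in> g - Id" if "(p, q) \<in> ?s - Id" for p q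
    proof -
      from that have pq: "p \<in> Field ?s" "q \<in> Field ?s" "(p, q) \<in> ?s" "p \<noteq> q"
        by (auto intro: FieldI1 FieldI2)
      then obtain i t where p: "p = Inl (i, t)" "i < n"
        unfolding F by (cases p; cases q) (auto simp: simps)
      have px: "(h p, x j) \<in> g - Id" if "i \<le> j" "j < n" for j
      proof -
        have "(h p, x i) \<in> g - Id"
          using x_less[of "i - 1" i] bx[of i t] p by (auto simp: h_def)
        then show ?thesis
          using trg[OF _ x_less[of i j]] that by (cases "i = j") auto
      qed
      show ?thesis
      proof (cases q)
        case (Inr v)
        then show ?thesis
          using px[of "n - 1"] p n by (simp add: h_def)
      next
        case (Inl v)
        obtain j u where v: "v = (j, u)" by fastforce
        have j: "j < n" "i < j \<or> i = j \<and> t < u"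
          using pq p Inl v by (auto simp: simps)
        show ?thesis
        proof (cases "i < j")
          case True
          then have "(h p, x (j - 1)) \<in> g - Id"
            using px[of "j - 1"] j by auto
          then show ?thesis
            using Inl v True trg[OF _ x_le_b[of "j - 1" j u]] j by (auto simp: h_def)
        next
          case False
          then show ?thesis
            using Inl v j p x_le_b[of "i - 1" i u] b_less[of i t u] by (auto simp: h_def)
        qed
      qed
    qed
    fix q assume q: "q \<in> Field ?s"
    then consider "q = Inr 0" | i t where "q = Inl (i, t)" "i < n"
      unfolding F by auto
    then show "(\<forall>i\<in>Field ?s. (q, i) \<in> ?s) \<or>
        (\<exists>k\<in>Field ?s. \<forall>i\<in>Field ?s. (q, i) \<in> ?s \<longleftrightarrow> (k, i) \<in> ?s - Id) \<or>
        (\<forall>z. (z, h q) \<in> g - Id \<longrightarrow> (\<exists>i. (i, q) \<in> ?s - Id \<and> (z, h i) \<in> g - Id))"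
    proof cases
      case 1
      have "\<exists>p. (p, q) \<in> ?s - Id \<and> (z, h p) \<in> g - Id" if "(z, h q) \<in> g - Id" for z
      proof -
        have "(z, x (n - 1)) \<in> g - Id"
          using that 1 by (simp add: h_def)
        then obtain t where "(z, b (n - 1) t) \<in> g - Id"
          using lim[of "n - 1"] n by auto
        \<comment> \<open>The shift to \<open>Suc t\<close> avoids index \<open>0\<close>, where
          \<open>h\<close> may take the limit point of the preceding block instead of a value of
          \<open>b\<close>.\<close>
        then have "(z, b (n - 1) (Suc t)) \<in> g - Id"
          using trg[OF _ bb[of "n - 1" t]] n by auto
        then show ?thesis
          using 1 n by (intro exI[of _ "Inl (n - 1, Suc t)"]) (auto simp: h_def simps)
      qed
      then show ?thesis by blast
    next
      case (2 i t)
      consider "t = 0" "i = 0" | "t = 0" "0 < i" | "0 < t" by auto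
      then show ?thesis
      proof cases
        case 1
        then have "\<forall>p\<in>Field ?s. (q, p) \<in> ?s"
          unfolding F using 2 by (auto simp: simps)
        then show ?thesis by blast
      next
        case c: 2
        have "\<exists>p. (p, q) \<in> ?s - Id \<and> (z, h p) \<in> g - Id" if "(z, h q) \<in> g - Id" for z
        proof -
          have "(z, x (i - 1)) \<in> g - Id"
            using that 2 c by (simp add: h_def)
          moreover have i: "i - 1 < n"
            using 2(2) by linarith
          ultimately obtain u where "(z, b (i - 1) u) \<in> g - Id"
            using lim by blast
          then have "(z, b (i - 1) (Suc u)) \<in> g - Id"
            using trg[OF _ bb] i by blast
          then show ?thesis
            using 2 c i by (intro exI[of _ "Inl (i - 1, Suc u)"]) (auto simp: h_def simps)
        qed
        then show ?thesis by blast
      next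
        case 3
        have "Inl (i, t - 1) \<in> Field ?s"
          unfolding F using 2 by simp
        moreover have "(q, p) \<in> ?s \<longleftrightarrow> (Inl (i, t - 1), p) \<in> ?s - Id" if "p \<in> Field ?s" for p
          using that 2 3 unfolding F by (auto simp: simps)
        ultimately show ?thesis by blast
      qed
    qed
  qed
  moreover have "h ` Field ?s \<subseteq> {x i |i. i < n} \<union> {b i t |i t. i < n}"
  proof (rule image_subsetI)
    fix p assume "p \<in> Field ?s"
    then consider "p = Inr 0" | i t where "p = Inl (i, t)" "i < n"
      unfolding F by auto
    then show "h p \<in> {x i |i. i < n} \<union> {b i t |i t. i < n}"
    proof cases
      case 1
      then have "h p = x (n - 1)" "n - 1 < n"
        using n by (simp_all add: h_def)
      then show ?thesis by blast
    next
      case (2 i t)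
      then have "h p = x (i - 1) \<and> i - 1 < n \<or> h p = b i t"
        by (auto simp: h_def)
      then show ?thesis using 2(2) by blast
    qed
  qed
  ultimately show ?thesis
    unfolding N_def U_def by blast
qed

section \<open>The ordinal \<open>\<omega>\<^sup>4 \<cdot> M + 1\<close> as a tree of limit points\<close>

text \<open>\<open>Inl (i, a, b, c, d)\<close> is the ordinal \<open>\<omega>\<^sup>4 \<cdot> i +
  \<omega>\<^sup>3 \<cdot> a + \<omega>\<^sup>2 \<cdot> b + \<omega> \<cdot> c + d\<close>, and
  \<open>Inr 0\<close> is the last point.\<close>

definition gamma_order :: "nat \<Rightarrow> ((nat \<times> nat \<times> nat \<times> nat \<times> nat) + nat) rel" where
  "gamma_order M = omega_pow_4 *\<^sub>o natLeq_on M +\<^sub>o natLeq_on 1"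

lemma Well_order_gamma_order: "Well_order (gamma_order M)"
  unfolding gamma_order_def
  by (intro Well_order_osum Well_order_oprod natLeq_on_Well_order natLeq_Well_order)

lemma Field_gamma_order: "Field (gamma_order M) = Inl ` ({..<M} \<times> UNIV) \<union> {Inr 0}"
proof -
  have "Refl omega_pow_4"
    by (intro Refl_oprod natLeq_Refl)
  then show ?thesis
    unfolding gamma_order_def Field_osum Field_oprod[OF \<open>Refl omega_pow_4\<close>] Field_natLeq_on Field_omega_pow_4
    by auto
qed

lemma in_gamma_order_iff [simp]:
  "(Inl (i, a, b, c, d), Inl (i', a', b', c', d')) \<in> gamma_order M \<longleftrightarrow>
    i < M \<and> i' < M \<and> (i < i' \<or> i = i' \<and> (a < a' \<or> a = a' \<and> (b < b' \<or> b = b' \<and>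
      (c < c' \<or> c = c' \<and> d \<le> d'))))"
  "(Inl (i, a, b, c, d), Inr k) \<in> gamma_order M \<longleftrightarrow> i < M \<and> k = 0"
  "(Inr k, Inr l) \<in> gamma_order M \<longleftrightarrow> k = 0 \<and> l = 0"
  "(Inr k, Inl p) \<notin> gamma_order M"
proof -
  have R: "Refl omega_pow_4"
    by (intro Refl_oprod natLeq_Refl)
  show "(Inl (i, a, b, c, d), Inl (i', a', b', c', d')) \<in> gamma_order M \<longleftrightarrow>
    i < M \<and> i' < M \<and> (i < i' \<or> i = i' \<and> (a < a' \<or> a = a' \<and> (b < b' \<or> b = b' \<and>
      (c < c' \<or> c = c' \<and> d \<le> d'))))"
    unfolding gamma_order_def in_osum_simps in_oprod_iff Field_omega_pow_4 Field_natLeq_on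
      Field_oprod[OF Refl_oprod[OF natLeq_Refl natLeq_Refl]] Field_oprod_natLeq Field_natLeq
    by (auto simp: less_le)
  show "(Inl (i, a, b, c, d), Inr k) \<in> gamma_order M \<longleftrightarrow> i < M \<and> k = 0"
    unfolding gamma_order_def in_osum_simps Field_natLeq_on Field_oprod[OF R] Field_omega_pow_4
    by auto
qed (auto simp: gamma_order_def)

text \<open>
  The node \<open>pt M (i # t)\<close> with \<open>length t = l\<close> is a point of Cantor-Bendixson rank \<open>4 - l\<close>
 , namely the supremum of the block of all ordinals whose leading coordinates are
  \<open>i # t\<close>. So \<open>pt M [i]\<close> is \<open>\<omega>\<^sup>4 \<cdot> (i + 1)\<close>, and \<open>pt M (s @ [a])\<close> converges to \<open>pt M s\<close>.
\<close>

fun pt :: "nat \<Rightarrow> nat list \<Rightarrow> (nat \<times> nat \<times> nat \<times> nat \<times> nat) + nat" where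
  "pt M [i] = (if Suc i < M then Inl (Suc i, 0, 0, 0, 0) else Inr 0)"
| "pt M [i, a] = Inl (i, Suc a, 0, 0, 0)"
| "pt M [i, a, b] = Inl (i, a, Suc b, 0, 0)"
| "pt M [i, a, b, c] = Inl (i, a, b, Suc c, 0)"
| "pt M [i, a, b, c, d] = Inl (i, a, b, c, Suc d)"
| "pt M _ = Inr 0"

text \<open>Outside the lengths 1 to 5 the function \<open>pt\<close> returns only a default
  value.\<close>

definition node :: "nat \<Rightarrow> nat list \<Rightarrow> bool" where
  "node M s \<longleftrightarrow> s \<noteq> [] \<and> length s \<le> 5 \<and> hd s < M"

lemma node_cases:
  assumes "node M s"
  obtains i where "s = [i]" "i < M" | i a where "s = [i, a]" "i < M" | i a b where "s = [i, a, b]" "i < M"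
  | i a b c where "s = [i, a, b, c]" "i < M" | i a b c d where "s = [i, a, b, c, d]" "i < M"
proof -
  have "length s = 1 \<or> length s = 2 \<or> length s = 3 \<or> length s = 4 \<or> length s = 5"
    using assms length_greater_0_conv[of s] unfolding node_def by linarith
  then show thesis
    using assms that by (auto simp: node_def length_Suc_conv eval_nat_numeral)
qed

lemma pt_in_Field:
  assumes "node M s"
  shows "pt M s \<in> Field (gamma_order M)"
  using assms by (rule node_cases) (auto simp: Field_gamma_order)

text \<open>The first point lies at or below the end of the block of \<open>s @ [a]\<close>, the
  block of \<open>s @ [a']\<close> starts no earlier than that end, and \<open>pt\<close> is
  strictly above the start of each block containing it.\<close>

lemma pt_less_pt:
  assumes "node M (s @ a # t)" "node M (s @ a' # t')" "a < a'"
  shows "(pt M (s @ a # t), pt M (s @ a' # t')) \<in> gamma_order M - Id"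
  by (rule node_cases[OF assms(1)]; rule node_cases[OF assms(2)])
    (use assms(3) in \<open>auto simp: append_eq_Cons_conv\<close>)

lemma pt_append_less:
  assumes "node M (s @ a # t)" "s \<noteq> []"
  shows "(pt M (s @ a # t), pt M s) \<in> gamma_order M - Id"
proof -
  have "node M s"
    using assms by (auto simp: node_def)
  show ?thesis
    by (rule node_cases[OF \<open>node M s\<close>]; rule node_cases[OF assms(1)])
      auto
qed

text \<open>The bound \<open>K\<close> is uniform in the tail \<open>t\<close>. So one arbitrary
  descendant from each of infinitely many children of \<open>s\<close> already gives a sequence with
  limit \<open>pt M s\<close>.\<close>

lemma pt_converges:
  assumes "node M s" and z: "(z, pt M s) \<in> gamma_order M - Id"
  shows "\<exists>K. \<forall>a\<ge>K. \<forall>t. node M (s @ a # t) \<longrightarrow> (z, pt M (s @ a # t)) \<in> gamma_order M - Id"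
proof -
  obtain e0 e1 e2 e3 e4 where zE: "z = Inl (e0, e1, e2, e3, e4)"
  proof (cases z)
    case (Inr k)
    with z show ?thesis
      by (cases "pt M s") auto
  qed (metis prod_cases5 that)
  \<comment> \<open>Which coordinate of \<open>z\<close> competes with \<open>a\<close> depends on
    the length of \<open>s\<close>; the sum bounds all candidates at once.\<close>
  have "(z, pt M (s @ a # t)) \<in> gamma_order M - Id"
    if "Suc (e1 + e2 + e3 + e4) \<le> a" and t: "node M (s @ a # t)" for a t
    by (rule node_cases[OF assms(1)]; rule node_cases[OF t])
      (use z zE that in \<open>auto split: if_splits\<close>)
  then show ?thesis by blast
qed

declare pt.simps [simp del]

section \<open>Iterated ultrafilter quantifiers and blue levels\<close>

text \<open>Zorn's lemma gives a minimal proper filter below \<open>sequentially\<close>; minimality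
  makes it decide every predicate.\<close>

lemma ex_free_ultrafilter:
  "\<exists>F :: nat filter. F \<noteq> bot \<and> F \<le> sequentially \<and>
    (\<forall>P. eventually P F \<or> eventually (\<lambda>x. \<not> P x) F)"
proof -
  let ?A = "{F :: nat filter. F \<noteq> bot \<and> F \<le> sequentially}"
  have "\<exists>F\<in>?A. \<forall>G\<in>?A. F \<ge> G \<longrightarrow> G = F"
  proof (rule predicate_Zorn)
    show "partial_order_on ?A (relation_of (\<ge>) ?A)"
      by (rule partial_order_on_relation_ofI) auto
    fix C assume C: "C \<in> Chains (relation_of (\<ge>) ?A)"
    show "\<exists>u\<in>?A. \<forall>a\<in>C. a \<ge> u"
    proof (cases "C = {}")
      case True
      then show ?thesis by (intro bexI[of _ sequentially]) auto
    next
      case False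
      have CA: "C \<subseteq> ?A" and lin: "\<And>F G. F \<in> C \<Longrightarrow> G \<in> C \<Longrightarrow> F \<le> G \<or> G \<le> F"
        using C unfolding Chains_def relation_of_def by blast+
      \<comment> \<open>A chain is a base of its infimum, so the infimum is proper because every
        member is.\<close>
      have "eventually (\<lambda>x. False) (Inf C) \<longleftrightarrow> (\<exists>F\<in>C. eventually (\<lambda>x. False) F)"
      proof (rule eventually_Inf_base[OF False])
        fix F G assume "F \<in> C" "G \<in> C"
        then show "\<exists>H\<in>C. H \<le> inf F G"
          using lin[of F G] by (metis inf.order_iff inf_commute order_refl)
      qed
      then have "\<not> eventually (\<lambda>x. False) (Inf C)"
        using CA by (auto simp: trivial_limit_def)
      moreover obtain G where "G \<in> C" using False by blast
      then have "Inf C \<le> sequentially"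
        using CA Inf_lower[of G C] by (auto intro: order_trans)
      ultimately show ?thesis
        by (intro bexI[of _ "Inf C"] ballI Inf_lower) (simp_all add: trivial_limit_def)
    qed
  qed
  then obtain F where F: "F \<noteq> bot" "F \<le> sequentially"
    and *: "\<forall>G\<in>?A. F \<ge> G \<longrightarrow> G = F"
    by blast
  have min: "G = F" if "G \<noteq> bot" "G \<le> F" for G
    using * that order_trans[OF that(2) F(2)] by blast
  have "eventually P F" if "\<not> eventually (\<lambda>x. \<not> P x) F" for P
  proof -
    \<comment> \<open>Restricting \<open>F\<close> to \<open>P\<close> stays proper, so by
      minimality it changes nothing and \<open>P\<close> holds eventually.\<close>
    have "inf F (principal {x. P x}) \<noteq> bot"
      using that by (simp add: trivial_limit_def eventually_inf_principal)
    then have "inf F (principal {x. P x}) = F"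
      by (rule min) simp
    then show ?thesis
      using eventually_inf_principal[of P F "{x. P x}"] by simp
  qed
  with F show ?thesis by blast
qed

text \<open>This is the iterated (Fubini) power of \<open>F\<close> on the extensions of
  \<open>s\<close> by \<open>k\<close> entries: almost all first entries, then almost all second
  entries, and so on.\<close>

primrec iter_ev :: "nat filter \<Rightarrow> nat \<Rightarrow> (nat list \<Rightarrow> bool) \<Rightarrow> nat list \<Rightarrow> bool" where
  "iter_ev F 0 P s \<longleftrightarrow> P s"
| "iter_ev F (Suc k) P s \<longleftrightarrow> (\<forall>\<^sub>F a in F. iter_ev F k P (s @ [a]))"

section \<open>Rules for the iterated quantifier\<close>

lemma iter_ev_conj:
  "iter_ev F k (\<lambda>s. P s \<and> Q s) s \<longleftrightarrow> iter_ev F k P s \<and> iter_ev F k Q s"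
  by (induction k arbitrary: s) (simp_all add: eventually_conj_iff)

text \<open>Used to view a property of a deep level as a property of the nodes at a level above
  it.\<close>

lemma iter_ev_add: "iter_ev F (j + k) P s \<longleftrightarrow> iter_ev F j (iter_ev F k P) s"
  by (induction j arbitrary: s) simp_all

text \<open>The ultrafilter property moves the negation inward through one quantifier at a
  time.\<close>

lemma iter_ev_not:
  assumes ultra: "\<And>P. eventually P F \<or> (\<forall>\<^sub>F x in F. \<not> P x)"
    and "\<not> iter_ev F k P s"
  shows "iter_ev F k (\<lambda>s. \<not> P s) s"
  using assms(2)
proof (induction k arbitrary: s)
  case (Suc k)
  then have "\<forall>\<^sub>F a in F. \<not> iter_ev F k P (s @ [a])"
    using ultra[of "\<lambda>a. iter_ev F k P (s @ [a])"] by simp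
  then show ?case
    by (auto elim: eventually_mono intro: Suc.IH)
qed simp

lemma iter_ev_ball_finite:
  assumes "finite A" "\<And>y. y \<in> A \<Longrightarrow> iter_ev F k (P y) s"
  shows "iter_ev F k (\<lambda>s. \<forall>y\<in>A. P y s) s"
  using assms(2)
proof (induction k arbitrary: s)
  case (Suc k)
  then have "\<forall>\<^sub>F a in F. \<forall>y\<in>A. iter_ev F k (P y) (s @ [a])"
    using assms(1) by (intro eventually_ball_finite) auto
  then show ?case
    by (auto elim!: eventually_mono intro: Suc.IH)
qed simp

lemma iter_ev_ex:
  assumes "F \<noteq> bot" "iter_ev F k P s"
  shows "\<exists>t. length t = k \<and> P (s @ t)"
  using assms(2)
proof (induction k arbitrary: s)
  case (Suc k)
  then obtain a where "iter_ev F k P (s @ [a])"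
    using eventually_happens'[OF assms(1)] unfolding iter_ev.simps by blast
  then obtain t where "length t = k" "P ((s @ [a]) @ t)"
    using Suc.IH by blast
  then show ?case
    by (intro exI[of _ "a # t"]) simp
qed simp

text \<open>A set in a proper filter below \<open>sequentially\<close> meets every final segment, so
  it is infinite and can be enumerated.\<close>

lemma eventually_imp_strict_mono_sequence:
  assumes "F \<noteq> bot" "F \<le> sequentially" "eventually P F"
  shows "\<exists>\<alpha>. strict_mono (\<alpha> :: nat \<Rightarrow> nat) \<and> (\<forall>j. P (\<alpha> j))"
proof -
  have "\<exists>a\<ge>K. P a" for K
    using eventually_happens'[OF assms(1) eventually_conj[OF assms(3)
        filter_leD[OF assms(2) eventually_ge_at_top[of K]]]] by blast
  then have "infinite {a. P a}"
    by (simp add: infinite_nat_iff_unbounded_le)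
  then show ?thesis
    using strict_mono_enumerate enumerate_in_set by blast
qed

text \<open>Almost every child of \<open>s\<close> has a descendant satisfying \<open>P\<close>.
  Choosing one for each of infinitely many children gives an increasing sequence, which converges
  whatever the tails are.\<close>

lemma ex_sequence_converging_to_pt:
  assumes F: "F \<noteq> bot" "F \<le> sequentially"
    and s: "node M s" "length s + Suc k \<le> 5" and P: "iter_ev F (Suc k) P s"
  shows "\<exists>u :: nat \<Rightarrow> nat list. (\<forall>m. P (u m) \<and> node M (u m) \<and> (\<exists>a t. u m = s @ a # t)) \<and>
    (\<forall>m l. m < l \<longrightarrow> (pt M (u m), pt M (u l)) \<in> gamma_order M - Id) \<and>
    (\<forall>z. (z, pt M s) \<in> gamma_order M - Id \<longrightarrow>
      (\<exists>m0. \<forall>m\<ge>m0. (z, pt M (u m)) \<in> gamma_order M - Id))"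
proof -
  have "\<forall>\<^sub>F a in F. \<exists>t. length t = k \<and> P ((s @ [a]) @ t)"
    using P unfolding iter_ev.simps by (rule eventually_mono) (rule iter_ev_ex[OF F(1)])
  from eventually_imp_strict_mono_sequence[OF F this] obtain \<alpha> :: "nat \<Rightarrow> nat"
    where \<alpha>: "strict_mono \<alpha>" and "\<And>j. \<exists>t. length t = k \<and> P ((s @ [\<alpha> j]) @ t)"
    by blast
  then obtain \<tau> where \<tau>: "length (\<tau> j) = k" "P (s @ \<alpha> j # \<tau> j)" for j
    by (metis append.assoc append_Cons append_Nil)
  define u where "u j = s @ \<alpha> j # \<tau> j" for j
  have node: "node M (u j)" for j
    using s \<tau>(1)[of j] by (auto simp: node_def u_def)
  show ?thesis
  proof (intro exI[of _ u] conjI allI impI)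
    show "(pt M (u m), pt M (u l)) \<in> gamma_order M - Id" if "m < l" for m l
      using pt_less_pt node strict_monoD[OF \<alpha> that] unfolding u_def by blast
    fix z assume "(z, pt M s) \<in> gamma_order M - Id"
    then obtain K where "\<And>a t. a \<ge> K \<Longrightarrow> node M (s @ a # t) \<Longrightarrow> (z, pt M (s @ a # t)) \<in> gamma_order M - Id"
      using pt_converges[OF s(1)] by blast
    \<comment> \<open>Since \<open>m \<le> \<alpha> m\<close>, the bound \<open>K\<close> on entries
      also serves as the bound on indices.\<close>
    then show "\<exists>m0. \<forall>m\<ge>m0. (z, pt M (u m)) \<in> gamma_order M - Id"
      using node strict_mono_imp_increasing[OF \<alpha>] unfolding u_def by (meson le_trans)
  qed (use \<tau>(2) node in \<open>auto simp: u_def\<close>)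
qed

text \<open>The failure of the partition relation, phrased for a symmetric relation; red means not
  blue. The points in \<open>no_blue_triangle\<close> may coincide, which makes \<open>blue\<close>
  irreflexive on the field. The value of \<open>M\<close> is left open until the final contradiction
  is prepared.\<close>

locale counterexample =
  fixes n M :: nat and F :: "nat filter"
    and blue :: "(nat \<times> nat \<times> nat \<times> nat \<times> nat) + nat \<Rightarrow> (nat \<times> nat \<times> nat \<times> nat \<times> nat) + nat \<Rightarrow> bool"
  assumes n_pos: "0 < n"
    and F: "F \<noteq> bot" "F \<le> sequentially"
    and ultra: "\<And>P. eventually P F \<or> (\<forall>\<^sub>F x in F. \<not> P x)"
    and blue_sym: "\<And>x y. blue x y \<Longrightarrow> blue y x"
    and no_blue_triangle: "\<And>x y z. \<lbrakk>x \<in> Field (gamma_order M); y \<in> Field (gamma_order M);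
      z \<in> Field (gamma_order M); blue x y; blue y z; blue x z\<rbrakk> \<Longrightarrow> False"
    and no_red_copy: "\<And>X. \<lbrakk>X \<subseteq> Field (gamma_order M);
      closed_copy (gamma_order M) X (natLeq *\<^sub>o natLeq_on n +\<^sub>o natLeq_on 1)\<rbrakk>
      \<Longrightarrow> \<exists>x\<in>X. \<exists>y\<in>X. blue x y"
begin

text \<open>Level \<open>l\<close> below the top point \<open>pt M [i]\<close> consists of points of
  rank \<open>4 - l\<close>, so \<open>l = 1, ..., 4\<close> covers the ranks 3 down to 0.\<close>

definition blue_level :: "nat \<Rightarrow> (nat \<times> nat \<times> nat \<times> nat \<times> nat) + nat \<Rightarrow> nat \<Rightarrow> bool" where
  "blue_level l y i \<longleftrightarrow> iter_ev F l (\<lambda>s. blue y (pt M s)) [i]"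

text \<open>
  If \<open>y\<close> were blue to two levels below \<open>pt M [i]\<close>, then the coarser level would contain limits of
  the finer one, so the blue neighbourhood of \<open>y\<close>, which is red by triangle-freeness, would contain
  a closed copy of \<open>\<omega> \<cdot> n + 1\<close>.
\<close>

lemma no_two_blue_levels:
  assumes y: "y \<in> Field (gamma_order M)" and i: "i < M"
    and l: "0 < l" "l < l'" "l' \<le> 4" and blue: "blue_level l y i" "blue_level l' y i"
  shows False
proof -
  let ?G = "gamma_order M"
  define B where "B s \<longleftrightarrow> blue y (pt M s)" for s
  obtain m where m: "l = m + 1"
    using l(1) by (metis Suc_eq_plus1 gr0_conv_Suc)
  obtain k where k: "l' = l + Suc k"
    using l(2) less_imp_Suc_add by auto
  define R where "R s \<longleftrightarrow> B s \<and> iter_ev F (Suc k) B s" for s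
  have "iter_ev F l R [i]"
    using blue unfolding blue_level_def B_def[symmetric] k iter_ev_add R_def iter_ev_conj by blast
  \<comment> \<open>The last of the \<open>l\<close> quantifiers is split off, so that the limit
    points can be chosen as children of a single node \<open>s\<close>, ordered by their last
    entry.\<close>
  then have "iter_ev F m (iter_ev F 1 R) [i]"
    unfolding m iter_ev_add .
  then obtain t where t: "length t = m" "iter_ev F 1 R ([i] @ t)"
    using iter_ev_ex[OF F(1)] by blast
  define s where "s = i # t"
  have "\<forall>\<^sub>F a in F. R (s @ [a])"
    using t(2) by (simp add: s_def)
  from eventually_imp_strict_mono_sequence[OF F this]
  obtain \<alpha> :: "nat \<Rightarrow> nat" where \<alpha>: "strict_mono \<alpha>" "\<And>j. R (s @ [\<alpha> j])"
    by blast
  have ns: "node M (s @ [\<alpha> j])" "length (s @ [\<alpha> j]) + Suc k \<le> 5" for j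
    using i l t(1) m k by (auto simp: node_def s_def)
  have "\<exists>u :: nat \<Rightarrow> nat list. (\<forall>m. B (u m) \<and> node M (u m) \<and> (\<exists>a t. u m = (s @ [\<alpha> j]) @ a # t)) \<and>
    (\<forall>m l. m < l \<longrightarrow> (pt M (u m), pt M (u l)) \<in> ?G - Id) \<and>
    (\<forall>z. (z, pt M (s @ [\<alpha> j])) \<in> ?G - Id \<longrightarrow> (\<exists>m0. \<forall>m\<ge>m0. (z, pt M (u m)) \<in> ?G - Id))" for j
    using ex_sequence_converging_to_pt[OF F ns] \<alpha>(2)[of j] unfolding R_def by blast
  then obtain u :: "nat \<Rightarrow> nat \<Rightarrow> nat list" where u: "\<And>j m. B (u j m)" "\<And>j m. node M (u j m)"
      "\<And>j m. \<exists>a t. u j m = (s @ [\<alpha> j]) @ a # t"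
      "\<And>j m l. m < l \<Longrightarrow> (pt M (u j m), pt M (u j l)) \<in> ?G - Id"
      "\<And>j z. (z, pt M (s @ [\<alpha> j])) \<in> ?G - Id \<Longrightarrow> \<exists>m0. \<forall>m\<ge>m0. (z, pt M (u j m)) \<in> ?G - Id"
    by metis
  have "\<exists>X \<subseteq> {pt M (s @ [\<alpha> j]) |j. j < n} \<union> {pt M (u j m) |j m. j < n}.
    closed_copy ?G X (natLeq *\<^sub>o natLeq_on n +\<^sub>o natLeq_on 1)"
  proof (rule closed_copy_omega_times_plus_one[OF Well_order_gamma_order n_pos])
    show "(pt M (u j m), pt M (u j (Suc m))) \<in> ?G - Id" for j m
      using u(4) by blast
    show "(pt M (u j m), pt M (s @ [\<alpha> j])) \<in> ?G - Id" for j m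
      using u(2)[of j m] u(3)[of j m] pt_append_less[of M "s @ [\<alpha> j]"] by auto
    show "(pt M (s @ [\<alpha> j]), pt M (u (Suc j) 0)) \<in> ?G - Id" for j
    proof -
      obtain a t where at: "u (Suc j) 0 = s @ \<alpha> (Suc j) # a # t"
        using u(3)[of "Suc j" 0] by auto
      show ?thesis
        using pt_less_pt[of M s "\<alpha> j" "[]" "\<alpha> (Suc j)" "a # t"] ns(1)[of j] u(2)[of "Suc j" 0]
          strict_monoD[OF \<alpha>(1), of j "Suc j"] by (simp add: at)
    qed
    show "\<exists>m. (z, pt M (u j m)) \<in> ?G - Id" if "(z, pt M (s @ [\<alpha> j])) \<in> ?G - Id" for j z
      using u(5)[OF that] by blast
  qed
  then obtain X where X: "X \<subseteq> {pt M (s @ [\<alpha> j]) |j. j < n} \<union> {pt M (u j m) |j m. j < n}"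
    and copy: "closed_copy ?G X (natLeq *\<^sub>o natLeq_on n +\<^sub>o natLeq_on 1)"
    by blast
  \<comment> \<open>All of \<open>X\<close> is blue to \<open>y\<close>, so a blue pair inside
    \<open>X\<close> closes a triangle with \<open>y\<close>.\<close>
  have XB: "x \<in> Field ?G \<and> blue y x" if "x \<in> X" for x
    using X that ns(1) u(1,2) \<alpha>(2) pt_in_Field unfolding R_def B_def by blast
  then obtain v w where "v \<in> X" "w \<in> X" "blue v w"
    using no_red_copy[OF _ copy] by blast
  then show False
    using no_blue_triangle[of y v w] XB y by blast
qed

lemma blue_level_unique:
  assumes "y \<in> Field (gamma_order M)" "i < M" "l \<in> {1..4}" "l' \<in> {1..4}"
    "blue_level l y i" "blue_level l' y i"
  shows "l = l'"
  using assms no_two_blue_levels[of y i l l'] no_two_blue_levels[of y i l' l]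
  by (cases l l' rule: linorder_cases) auto

end

section \<open>Finite and infinite Ramsey properties\<close>

lemma ramsey_number_partn_lst: "partn_lst {..<ramsey_number k l} [k, l] 2"
  unfolding ramsey_number_def by (rule LeastI_ex) (rule ramsey_full)

text \<open>The colours of the two opposite edges are packed into one of \<open>r * r\<close>
  colours, and finite Ramsey applies. This shows that the least numbers defining \<open>A3\<close>
  and \<open>ramsey_K_L3\<close> exist.\<close>

lemma ex_homogeneous_digraph:
  fixes r k :: nat
  shows "\<exists>m>0. \<forall>c \<in> complete_digraph_edges m \<rightarrow> {..<r}.
    \<exists>S \<in> nsets {..<m} k. \<exists>p q. \<forall>a\<in>S. \<forall>b\<in>S. a < b \<longrightarrow> c (a, b) = p \<and> c (b, a) = q"
proof -
  obtain N :: nat where "partn_lst {..<N} (replicate (r * r) k) 2"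
    using ramsey_full by blast
  \<comment> \<open>Both definitions require a positive number of vertices, hence
    \<open>Suc N\<close>.\<close>
  then have N: "partn_lst {..<Suc N} (replicate (r * r) k) 2"
    by (rule partn_lst_greater_resource) simp
  show ?thesis
  proof (intro exI[of _ "Suc N"] conjI ballI)
    fix c assume c: "c \<in> complete_digraph_edges (Suc N) \<rightarrow> {..<r}"
    define f where "f e = c (Min e, Max e) * r + c (Max e, Min e)" for e :: "nat set"
    have f_eq: "f {a, b} = c (a, b) * r + c (b, a)" if "a < b" for a b
      using that by (simp add: f_def min_def max_def)
    have c_less: "c (a, b) < r" "c (b, a) < r" if "a < Suc N" "b < Suc N" "a < b" for a b
      using c that by (auto simp: complete_digraph_edges_def Pi_iff)
    have "f \<in> nsets {..<Suc N} 2 \<rightarrow> {..<r * r}"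
    proof
      fix e assume "e \<in> nsets {..<Suc N} 2"
      then obtain a b where ab: "e = {a, b}" "a < Suc N" "b < Suc N" "a < b"
        by (auto simp: ordered_nsets_2_eq)
      have "c (a, b) * r + c (b, a) < (c (a, b) + 1) * r"
        using c_less[OF ab(2-4)] by simp
      also have "\<dots> \<le> r * r"
        using c_less[OF ab(2-4)] by (intro mult_right_mono) auto
      finally show "f e \<in> {..<r * r}"
        using ab f_eq by simp
    qed
    then obtain i H where H: "i < r * r" "H \<in> nsets {..<Suc N} (replicate (r * r) k ! i)"
        "f ` nsets H 2 \<subseteq> {i}"
      using partn_lstE[OF N] by (metis length_replicate)
    have HN: "H \<subseteq> {..<Suc N}"
      using H(2) by (auto simp: nsets_def)
    have "c (a, b) = i div r \<and> c (b, a) = i mod r" if "a \<in> H" "b \<in> H" "a < b" for a b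
    proof -
      have "f {a, b} = i"
        using H(3) that by (auto simp: image_subset_iff)
      then show ?thesis
        using f_eq c_less[of a b] that HN by auto
    qed
    then show "\<exists>S\<in>nsets {..<Suc N} k. \<exists>p q. \<forall>a\<in>S. \<forall>b\<in>S. a < b \<longrightarrow> c (a, b) = p \<and> c (b, a) = q"
      using H by (intro bexI[of _ H] exI[of _ "i div r"] exI[of _ "i mod r"]) auto
  qed simp
qed

text \<open>On a homogeneous set only the forward colour \<open>p\<close> and the backward colour
  \<open>q\<close> occur, so some third colour is avoided at every vertex.\<close>

lemma A3_property:
  assumes "c \<in> complete_digraph_edges (A3 k) \<rightarrow> {0, 1, 2::nat}"
  shows "\<exists>S \<in> nsets {..<A3 k} k. \<forall>x \<in> S. \<exists>i \<in> {0, 1, 2}. \<forall>y \<in> S - {x}. c (y, x) \<noteq> i"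
proof -
  let ?P = "\<lambda>m. 0 < m \<and> (\<forall>c \<in> complete_digraph_edges m \<rightarrow> {0, 1, 2::nat}.
    \<exists>S \<in> nsets {..<m} k. \<forall>x \<in> S. \<exists>i \<in> {0, 1, 2}. \<forall>y \<in> S - {x}. c (y, x) \<noteq> i)"
  obtain m where m: "m > 0" and hom: "\<forall>c \<in> complete_digraph_edges m \<rightarrow> {..<3::nat}.
    \<exists>S \<in> nsets {..<m} k. \<exists>p q. \<forall>a\<in>S. \<forall>b\<in>S. a < b \<longrightarrow> c (a, b) = p \<and> c (b, a) = q"
    using ex_homogeneous_digraph[of 3 k] by blast
  have "?P m"
  proof (intro conjI ballI m)
    fix c assume "c \<in> complete_digraph_edges m \<rightarrow> {0, 1, 2::nat}"
    then have "c \<in> complete_digraph_edges m \<rightarrow> {..<3::nat}"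
      by (rule Pi_mono[THEN subsetD, rotated]) auto
    from bspec[OF hom this] obtain S p q where S: "S \<in> nsets {..<m} k"
      and "\<forall>a\<in>S. \<forall>b\<in>S. a < b \<longrightarrow> c (a, b) = p \<and> c (b, a) = q"
      by (elim bexE exE) (rule that)
    then have pq: "c (a, b) = p \<and> c (b, a) = q" if "a \<in> S" "b \<in> S" "a < b" for a b
      using that by simp
    have "\<exists>i\<in>{0, 1, 2}. i \<noteq> p \<and> i \<noteq> q"
      by auto
    then obtain i where i: "i \<in> {0, 1, 2}" "i \<noteq> p" "i \<noteq> q"
      by blast
    have "c (y, x) \<noteq> i" if "x \<in> S" "y \<in> S - {x}" for x y
      using pq[of x y] pq[of y x] that i by (cases x y rule: linorder_cases) auto
    with S i show "\<exists>S \<in> nsets {..<m} k. \<forall>x \<in> S. \<exists>i \<in> {0, 1, 2}. \<forall>y \<in> S - {x}. c (y, x) \<noteq> i"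
      by blast
  qed
  then have "?P (A3 k)"
    unfolding A3_def by (rule LeastI)
  with assms show ?thesis by blast
qed

text \<open>On a homogeneous set, either both directions are red, or one direction is blue and any
  three vertices, read in that direction, form a blue transitive triangle. Size \<open>n + 3\<close>
  leaves room for both outcomes.\<close>

lemma ramsey_K_L3_property:
  assumes "c \<in> complete_digraph_edges (ramsey_K_L3 n) \<rightarrow> {0, 1::nat}"
  shows "(\<exists>S \<in> nsets {..<ramsey_K_L3 n} n. \<forall>a \<in> S. \<forall>b \<in> S. a \<noteq> b \<longrightarrow> c (a, b) = 0) \<or>
    (\<exists>u \<in> {..<ramsey_K_L3 n}. \<exists>v \<in> {..<ramsey_K_L3 n}. \<exists>w \<in> {..<ramsey_K_L3 n}.
      u \<noteq> v \<and> v \<noteq> w \<and> u \<noteq> w \<and> c (u, v) = 1 \<and> c (v, w) = 1 \<and> c (u, w) = 1)"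
proof -
  let ?Q = "\<lambda>m c. (\<exists>S \<in> nsets {..<m} n. \<forall>a \<in> S. \<forall>b \<in> S. a \<noteq> b \<longrightarrow> c (a, b) = (0::nat)) \<or>
    (\<exists>u \<in> {..<m}. \<exists>v \<in> {..<m}. \<exists>w \<in> {..<m}.
      u \<noteq> v \<and> v \<noteq> w \<and> u \<noteq> w \<and> c (u, v) = 1 \<and> c (v, w) = 1 \<and> c (u, w) = 1)"
  let ?P = "\<lambda>m. 0 < m \<and> (\<forall>c \<in> complete_digraph_edges m \<rightarrow> {0, 1}. ?Q m c)"
  obtain m where m: "m > 0" and hom: "\<forall>c \<in> complete_digraph_edges m \<rightarrow> {..<2::nat}.
    \<exists>S \<in> nsets {..<m} (n + 3). \<exists>p q. \<forall>a\<in>S. \<forall>b\<in>S. a < b \<longrightarrow> c (a, b) = p \<and> c (b, a) = q"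
    using ex_homogeneous_digraph[of 2 "n + 3"] by blast
  have "?P m"
  proof (intro conjI ballI m)
    fix c assume c: "c \<in> complete_digraph_edges m \<rightarrow> {0, 1::nat}"
    then have "c \<in> complete_digraph_edges m \<rightarrow> {..<2::nat}"
      by (rule Pi_mono[THEN subsetD, rotated]) auto
    from bspec[OF hom this] obtain S p q where S: "S \<in> nsets {..<m} (n + 3)"
      and "\<forall>a\<in>S. \<forall>b\<in>S. a < b \<longrightarrow> c (a, b) = p \<and> c (b, a) = q"
      by (elim bexE exE) (rule that)
    then have pq: "c (a, b) = p \<and> c (b, a) = q" if "a \<in> S" "b \<in> S" "a < b" for a b
      using that by simp
    have Sm: "S \<subseteq> {..<m}" "finite S" "card S = n + 3"
      using S by (auto simp: nsets_def)
    have "nsets S 3 \<noteq> {}"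
      using Sm by (simp add: nsets_eq_empty_iff)
    then obtain T where "T \<in> nsets S 3"
      by blast
    then obtain x y z where xyz: "x \<in> S" "y \<in> S" "z \<in> S" "x < y" "y < z"
      by (auto simp: ordered_nsets_3_eq)
    have "c (x, y) \<in> {0, 1}" "c (y, x) \<in> {0, 1}"
      using c xyz Sm(1) by (auto simp: complete_digraph_edges_def Pi_iff)
    then consider "p = 0" "q = 0" | "p = 1" | "q = 1"
      using pq[of x y] xyz by auto
    then show "?Q m c"
    proof cases
      case 1
      have "nsets S n \<noteq> {}"
        using Sm by (simp add: nsets_eq_empty_iff)
      then obtain T where T: "T \<subseteq> S" "card T = n" "finite T"
        unfolding nsets_def by blast
      have "c (a, b) = 0" if "a \<in> T" "b \<in> T" "a \<noteq> b" for a b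
        using pq[of a b] pq[of b a] that T(1) 1 by (cases a b rule: linorder_cases) auto
      then show ?thesis
        using T Sm(1) by (intro disjI1 bexI[of _ T]) (auto simp: nsets_def)
    next
      case 2
      then have "c (x, y) = 1" "c (y, z) = 1" "c (x, z) = 1"
        using pq xyz by auto
      then show ?thesis
        using xyz Sm(1) by (intro disjI2 bexI[of _ x] bexI[of _ y] bexI[of _ z]) auto
    next
      case 3
      then have "c (z, y) = 1" "c (y, x) = 1" "c (z, x) = 1"
        using pq xyz by auto
      then show ?thesis
        using xyz Sm(1) by (intro disjI2 bexI[of _ z] bexI[of _ y] bexI[of _ x]) auto
    qed
  qed
  then have "?P (ramsey_K_L3 n)"
    unfolding ramsey_K_L3_def by (rule LeastI[where P = ?P])
  from conjunct2[OF this] assms show ?thesis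
    by (rule bspec)
qed

text \<open>Infinite Ramsey for pairs is applied once per index, shrinking the set each time;
  earlier homogeneity survives. Relations need not be symmetric, as a pair is read in increasing
  order.\<close>

lemma Ramsey_finite_family:
  fixes P :: "'i \<Rightarrow> nat \<Rightarrow> nat \<Rightarrow> bool"
  assumes "finite I" "infinite Z"
  shows "\<exists>Y \<subseteq> Z. infinite Y \<and> (\<forall>i\<in>I. \<exists>v. \<forall>m\<in>Y. \<forall>l\<in>Y. m < l \<longrightarrow> P i m l = v)"
  using assms(1)
proof (induction I rule: finite_induct)
  case empty
  then show ?case using assms(2) by blast
next
  case (insert i I)
  then obtain Y where Y: "Y \<subseteq> Z" "infinite Y" "\<forall>i\<in>I. \<exists>v. \<forall>m\<in>Y. \<forall>l\<in>Y. m < l \<longrightarrow> P i m l = v"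
    by blast
  define f :: "nat set \<Rightarrow> nat" where "f e = (if P i (Min e) (Max e) then 1 else 0)" for e
  have "\<forall>x\<in>Y. \<forall>y\<in>Y. x \<noteq> y \<longrightarrow> f {x, y} < 2"
    by (simp add: f_def)
  from Ramsey2[OF Y(2) this] obtain Y' t where Y': "Y' \<subseteq> Y" "infinite Y'"
    "\<forall>x\<in>Y'. \<forall>y\<in>Y'. x \<noteq> y \<longrightarrow> f {x, y} = t"
    by blast
  have "P i m l \<longleftrightarrow> t = 1" if "m \<in> Y'" "l \<in> Y'" "m < l" for m l
  proof -
    have "f {m, l} = t"
      using Y'(3) that by simp
    then show ?thesis
      using that(3) by (simp add: f_def min_def max_def split: if_splits)
  qed
  then have "\<exists>v. \<forall>m\<in>Y'. \<forall>l\<in>Y'. m < l \<longrightarrow> P i m l = v"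
    by blast
  moreover have "\<exists>v. \<forall>m\<in>Y'. \<forall>l\<in>Y'. m < l \<longrightarrow> P j m l = v" if j: "j \<in> I" for j
  proof -
    obtain v where "\<forall>m\<in>Y. \<forall>l\<in>Y. m < l \<longrightarrow> P j m l = v"
      using bspec[OF Y(3) j] by (rule exE)
    then have "\<forall>m\<in>Y'. \<forall>l\<in>Y'. m < l \<longrightarrow> P j m l = v"
      using Y'(1) by (simp add: subset_iff)
    then show ?thesis by (rule exI)
  qed
  ultimately have "\<forall>j\<in>insert i I. \<exists>v. \<forall>m\<in>Y'. \<forall>l\<in>Y'. m < l \<longrightarrow> P j m l = v"
    by (intro ballI) (metis insertE)
  with Y(1) Y'(1,2) show ?case
    by (intro exI[of _ Y'] conjI) auto
qed

section \<open>Red top points and the directed colouring\<close>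

context counterexample
begin

lemma not_blue_self: "x \<in> Field (gamma_order M) \<Longrightarrow> \<not> blue x x"
  using no_blue_triangle[of x x x] by blast

text \<open>The triangle alternative of the Ramsey number is excluded by
  \<open>no_blue_triangle\<close>.\<close>

lemma ex_red_tops:
  assumes "M = ramsey_number N 3"
  shows "\<exists>H \<in> nsets {..<M} N. \<forall>i\<in>H. \<forall>j\<in>H. \<not> blue (pt M [i]) (pt M [j])"
proof -
  have top: "pt M [i] \<in> Field (gamma_order M)" if "i < M" for i
    using that by (intro pt_in_Field) (simp add: node_def)
  define f :: "nat set \<Rightarrow> nat" where "f e = (if blue (pt M [Min e]) (pt M [Max e]) then 1 else 0)" for e
  have f_eq: "f {i, j} = (if blue (pt M [i]) (pt M [j]) then 1 else 0)" if "i < j" for i j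
    using that by (simp add: f_def min_def max_def)
  have part: "partn_lst {..<M} [N, 3] 2"
    unfolding assms by (rule ramsey_number_partn_lst)
  have f: "f \<in> nsets {..<M} 2 \<rightarrow> {..<2}"
    by (simp add: f_def)
  obtain k H where k: "k < length [N, 3]" and H: "H \<in> nsets {..<M} ([N, 3] ! k)"
    and fH: "f ` nsets H 2 \<subseteq> {k}"
    by (rule partn_lstE[OF part f]) (simp, rule that)
  have HM: "H \<subseteq> {..<M}"
    using H by (simp add: nsets_def)
  have col: "blue (pt M [i]) (pt M [j]) \<longleftrightarrow> k = 1" if "i \<in> H" "j \<in> H" "i < j" for i j
  proof -
    have "{i, j} \<in> nsets H 2"
      using that by simp
    then have "f {i, j} = k"
      using fH by blast
    then show ?thesis
      using f_eq[OF that(3)] by (simp split: if_splits)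
  qed
  have "k = 0"
  proof (rule ccontr)
    assume "k \<noteq> 0"
    then have "k = 1" using k by simp
    with H have "H \<in> nsets {..<M} 3" by simp
    then obtain x y z where xyz: "H = {x, y, z}" "x < M" "y < M" "z < M" "x < y" "y < z"
      by (auto simp: ordered_nsets_3_eq)
    then show False
      using no_blue_triangle[OF top top top, of x y z] col[of x y] col[of y z] col[of x z] \<open>k = 1\<close>
      by simp
  qed
  then have "H \<in> nsets {..<M} N"
    using H by simp
  moreover have "\<not> blue (pt M [i]) (pt M [j])" if "i \<in> H" "j \<in> H" for i j
  proof (cases i j rule: linorder_cases)
    case less
    then show ?thesis using col[OF that] \<open>k = 0\<close> by simp
  next
    case equal
    then show ?thesis using not_blue_self top that HM by blast
  next
    case greater
    then show ?thesis using col[OF that(2,1)] \<open>k = 0\<close> blue_sym[of "pt M [i]" "pt M [j]"] by auto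
  qed
  ultimately show ?thesis
    by blast
qed

text \<open>
  Four levels lie below each top point. One is lost to the top point itself, and the colour of
  \<open>(y, x)\<close> in the three-colouring names the remaining level of \<open>x\<close> that \<open>y\<close> sees blue, if any.
\<close>

lemma ex_red_tops_with_red_levels:
  assumes "M = ramsey_number (A3 k) 3"
  shows "\<exists>S \<in> nsets {..<M} k. (\<forall>x\<in>S. \<forall>y\<in>S. \<not> blue (pt M [x]) (pt M [y])) \<and>
    (\<forall>x\<in>S. \<exists>l\<in>{1..4}. \<forall>y\<in>S. \<not> blue_level l (pt M [y]) x)"
proof -
  obtain H where H: "H \<in> nsets {..<M} (A3 k)"
    and red: "\<forall>i\<in>H. \<forall>j\<in>H. \<not> blue (pt M [i]) (pt M [j])"
    using ex_red_tops[OF assms] by blast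
  have HM: "H \<subseteq> {..<M}" "finite H" "card H = A3 k"
    using H by (auto simp: nsets_def)
  have top: "pt M [i] \<in> Field (gamma_order M)" if "i \<in> H" for i
    using that HM by (intro pt_in_Field) (auto simp: node_def)
  obtain e where e: "bij_betw e {..<A3 k} H"
    using ex_bij_betw_nat_finite[OF HM(2)] HM(3) by (auto simp: lessThan_atLeast0)
  \<comment> \<open>If the top point sees none of its own levels blue, this choice is arbitrary and
    may lie outside \<open>{1..4}\<close>.\<close>
  define own where "own i = (SOME l. l \<in> {1..4} \<and> blue_level l (pt M [i]) i)" for i
  have own: "l = own i" if "i \<in> H" "l \<in> {1..4}" "blue_level l (pt M [i]) i" for i l
  proof -
    have "own i \<in> {1..4} \<and> blue_level (own i) (pt M [i]) i"
      unfolding own_def by (rule someI[of _ l]) (use that in simp)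
    then show ?thesis
      using blue_level_unique[OF top[OF that(1)] _ that(2) _ that(3)] that(1) HM(1) by auto
  qed
  \<comment> \<open>\<open>L i\<close> skips the value \<open>own i\<close>, so
    \<open>r = 0, 1, 2\<close> name three distinct levels in \<open>{1..4}\<close>, whatever
    \<open>own i\<close> is.\<close>
  define L where "L i r = (if r + 1 < own i then r + 1 else r + 2)" for i r :: nat
  have L: "L i r \<in> {1..4}" "L i r \<noteq> own i" if "r \<in> {0, 1, 2}" for i r
    using that by (auto simp: L_def)
  have L_inj: "r = r'" if "L i r = L i r'" for i r r'
    using that by (auto simp: L_def split: if_splits)
  define sees where "sees y x r \<longleftrightarrow> r \<in> {0, 1, 2} \<and> blue_level (L x r) (pt M [y]) x" for y x r
  \<comment> \<open>The default \<open>0\<close> is harmless: the argument only concludes from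
    \<open>seen y x \<noteq> r\<close> that \<open>y\<close> does not see level \<open>L x r\<close>
    blue.\<close>
  define seen where "seen y x = (if \<exists>r. sees y x r then SOME r. sees y x r else 0)" for y x
  have seen: "r = seen y x" if "x \<in> H" "y \<in> H" "sees y x r" for x y r
  proof -
    have "sees y x (seen y x)"
      using someI[of "sees y x" r] that(3) by (auto simp: seen_def)
    then have "L x r = L x (seen y x)"
      using blue_level_unique[OF top[OF that(2)] _ L(1) L(1)] that(1,3) HM(1) unfolding sees_def by blast
    then show ?thesis by (rule L_inj)
  qed
  have seen_range: "seen y x \<in> {0, 1, 2}" for x y
  proof (cases "\<exists>r. sees y x r")
    case True
    then have "sees y x (seen y x)"
      using someI_ex[OF True] by (simp add: seen_def)
    then show ?thesis
      unfolding sees_def by blast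
  qed (simp add: seen_def)
  have eH: "e a \<in> H" if "a < A3 k" for a
    using e that by (auto simp: bij_betw_def)
  have "(\<lambda>(a, b). seen (e a) (e b)) \<in> complete_digraph_edges (A3 k) \<rightarrow> {0, 1, 2}"
    by (rule Pi_I) (simp only: case_prod_unfold seen_range)
  from A3_property[OF this] obtain T where T: "T \<in> nsets {..<A3 k} k"
    and avoid: "\<forall>x\<in>T. \<exists>i\<in>{0, 1, 2}. \<forall>y\<in>T - {x}. seen (e y) (e x) \<noteq> i"
    by auto
  have TN: "T \<subseteq> {..<A3 k}" "finite T" "card T = k"
    using T by (auto simp: nsets_def)
  have inj: "inj_on e T"
    using e TN(1) by (auto simp: bij_betw_def intro: inj_on_subset)
  have eT: "e ` T \<subseteq> H"
    using eH TN(1) by auto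
  have "\<exists>l\<in>{1..4}. \<forall>y\<in>e ` T. \<not> blue_level l (pt M [y]) (e x)" if "x \<in> T" for x
  proof -
    obtain r where r: "r \<in> {0, 1, 2}" "\<forall>y\<in>T - {x}. seen (e y) (e x) \<noteq> r"
      using bspec[OF avoid \<open>x \<in> T\<close>] by (elim bexE) (rule that)
    have ex: "e x \<in> H" using eT that by blast
    \<comment> \<open>The top point itself is handled by skipping \<open>own\<close>, all others by
      the colour \<open>r\<close> that is avoided on edges into \<open>x\<close>.\<close>
    have "\<not> blue_level (L (e x) r) (pt M [e y]) (e x)" if "y \<in> T" for y
    proof (cases "y = x")
      case True
      then show ?thesis
        using own[OF ex L(1)[OF r(1)]] L(2)[OF r(1)] by blast
    next
      case False
      then have "seen (e y) (e x) \<noteq> r"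
        using r(2) that by simp
      moreover have "e y \<in> H"
        using eT that by blast
      ultimately show ?thesis
        using seen[OF ex, of "e y" r] r(1) unfolding sees_def by metis
    qed
    then have "\<forall>y\<in>e ` T. \<not> blue_level (L (e x) r) (pt M [y]) (e x)"
      by simp
    with L(1)[OF r(1)] show ?thesis
      by (rule bexI[rotated])
  qed
  then have "\<forall>x\<in>e ` T. \<exists>l\<in>{1..4}. \<forall>y\<in>e ` T. \<not> blue_level l (pt M [y]) x"
    by (intro ballI) (erule imageE, simp only:)
  moreover have "\<forall>x\<in>e ` T. \<forall>y\<in>e ` T. \<not> blue (pt M [x]) (pt M [y])"
    using red eT by blast
  moreover have "e ` T \<in> nsets {..<M} k"
    using eT HM(1) TN card_image[OF inj] by (auto simp: nsets_def)
  ultimately show ?thesis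
    by (intro bexI[of _ "e ` T"] conjI)
qed

text \<open>Sequences of a commonly red level are attached to the red top points. Their mutual
  colours form a digraph colouring without blue transitive triangles, and its red part yields the
  forbidden red copy.\<close>

lemma M_neq_ramsey_number: "M \<noteq> ramsey_number (A3 (ramsey_K_L3 n)) 3"
proof
  assume M: "M = ramsey_number (A3 (ramsey_K_L3 n)) 3"
  let ?G = "gamma_order M" and ?k = "ramsey_K_L3 n"
  obtain S where "S \<in> nsets {..<M} ?k"
    and redS: "\<forall>x\<in>S. \<forall>y\<in>S. \<not> blue (pt M [x]) (pt M [y])"
    and lev: "\<forall>x\<in>S. \<exists>l\<in>{1..4}. \<forall>y\<in>S. \<not> blue_level l (pt M [y]) x"
    using ex_red_tops_with_red_levels[OF M] by blast
  then have S: "S \<subseteq> {..<M}" "finite S" "card S = ?k"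
    by (auto simp: nsets_def)
  have nodeS: "node M [x]" if "x \<in> S" for x
    using S that by (auto simp: node_def)
  define P where "P s \<longleftrightarrow> (\<forall>y\<in>S. \<not> blue (pt M [y]) (pt M s))" for s
  define C where "C x u \<longleftrightarrow> (\<forall>m. P (u m) \<and> node M (u m) \<and> (\<exists>a t. u m = [x] @ a # t)) \<and>
    (\<forall>m l. m < l \<longrightarrow> (pt M (u m), pt M (u l)) \<in> ?G - Id) \<and>
    (\<forall>z. (z, pt M [x]) \<in> ?G - Id \<longrightarrow> (\<exists>m0. \<forall>m\<ge>m0. (z, pt M (u m)) \<in> ?G - Id))"
    for x and u :: "nat \<Rightarrow> nat list"
  have "\<exists>u. C x u" if x: "x \<in> S" for x
  proof -
    obtain l where l: "l \<in> {1..4}" "\<And>y. y \<in> S \<Longrightarrow> \<not> blue_level l (pt M [y]) x"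
      using lev x by blast
    \<comment> \<open>Each \<open>y\<close> in \<open>S\<close> fails to be blue to level
      \<open>l\<close>, so it is red to almost all of it; finitely many such conditions hold
      simultaneously.\<close>
    have "iter_ev F l P [x]"
      unfolding P_def using l(2)
      by (intro iter_ev_ball_finite S iter_ev_not ultra) (simp_all add: blue_level_def)
    moreover obtain j where j: "l = Suc j"
      using l(1) by (cases l) auto
    moreover have "length [x] + Suc j \<le> 5"
      using l(1) j by simp
    ultimately show ?thesis
      unfolding C_def using ex_sequence_converging_to_pt[OF F nodeS[OF x]] by blast
  qed
  then obtain u where u: "C x (u x)" if "x \<in> S" for x
    by metis
  have uP: "P (u x m)" "node M (u x m)" "\<exists>a t. u x m = x # a # t" if "x \<in> S" for x m
    using u[OF that] by (simp_all add: C_def)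
  have u_less: "(pt M (u x m), pt M (u x l)) \<in> ?G - Id" if "x \<in> S" "m < l" for x m l
    using u[OF that(1)] that(2) unfolding C_def by blast
  have u_lim: "\<exists>m0. \<forall>m\<ge>m0. (z, pt M (u x m)) \<in> ?G - Id" if "x \<in> S" "(z, pt M [x]) \<in> ?G - Id" for x z
    using u[OF that(1)] that(2) unfolding C_def by blast
  obtain Y where Y: "infinite Y" and hom: "\<forall>p\<in>S \<times> S. \<exists>v. \<forall>m\<in>Y. \<forall>l\<in>Y. m < l \<longrightarrow>
      blue (pt M (u (fst p) m)) (pt M (u (snd p) l)) = v"
    using Ramsey_finite_family[of "S \<times> S" UNIV "\<lambda>p m l. blue (pt M (u (fst p) m)) (pt M (u (snd p) l))"]
      S(2) by auto
  define h where "h = enumerate Y"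
  have h: "strict_mono h" "\<And>m. h m \<in> Y"
    using strict_mono_enumerate[OF Y] enumerate_in_set[OF Y] by (simp_all add: h_def)
  define v where "v x m = pt M (u x (h m))" for x m
  have v_Field: "v x m \<in> Field ?G" if "x \<in> S" for x m
    using pt_in_Field uP(2)[OF that] by (simp add: v_def)
  \<comment> \<open>By homogeneity, the indices 0 and 1 represent every pair
    \<open>m < l\<close>.\<close>
  define D where "D p \<longleftrightarrow> blue (v (fst p) 0) (v (snd p) 1)" for p
  have D: "blue (v x m) (v y l) = D (x, y)" if "x \<in> S" "y \<in> S" "m < l" for x y m l
  proof -
    have "(x, y) \<in> S \<times> S"
      using that by simp
    from bspec[OF hom this] obtain d
      where "\<forall>m\<in>Y. \<forall>l\<in>Y. m < l \<longrightarrow> blue (pt M (u x m)) (pt M (u y l)) = d"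
      unfolding fst_conv snd_conv by (rule exE)
    then have "blue (v x m) (v y l) = d" if "m < l" for m l
      using h(2) strict_monoD[OF h(1) that] by (simp add: v_def)
    then show ?thesis
      using that(3) by (simp add: D_def)
  qed
  \<comment> \<open>The increasing indices 0, 1, 2 match the transitive orientation. The vertices
    may coincide, so \<open>D (x, x)\<close> is false and each single sequence is red.\<close>
  have no_D_triangle: False if "x \<in> S" "y \<in> S" "z \<in> S" "D (x, y)" "D (y, z)" "D (x, z)" for x y z
    using no_blue_triangle[of "v x 0" "v y 1" "v z 2"] v_Field that D by simp
  obtain \<sigma> where \<sigma>: "bij_betw \<sigma> {..<?k} S"
    using ex_bij_betw_nat_finite[OF S(2)] S(3) by (auto simp: lessThan_atLeast0)
  have \<sigma>S: "\<sigma> a \<in> S" if "a < ?k" for a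
    using \<sigma> that by (auto simp: bij_betw_def)
  define c :: "nat \<times> nat \<Rightarrow> nat" where "c = (\<lambda>(a, b). if D (\<sigma> a, \<sigma> b) then 1 else 0)"
  have c: "c \<in> complete_digraph_edges ?k \<rightarrow> {0, 1}"
    by (rule Pi_I) (simp add: c_def case_prod_unfold)
  have no_c_triangle: "\<not> (c (i, j) = 1 \<and> c (j, l) = 1 \<and> c (i, l) = 1)"
    if "i < ?k" "j < ?k" "l < ?k" for i j l
    using no_D_triangle[OF \<sigma>S \<sigma>S \<sigma>S, OF that] by (auto simp: c_def)
  have "\<exists>T\<in>nsets {..<?k} n. \<forall>a\<in>T. \<forall>b\<in>T. a \<noteq> b \<longrightarrow> c (a, b) = 0"
    using ramsey_K_L3_property[OF c]
  proof (elim disjE bexE)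
    fix i j l assume "i \<in> {..<?k}" "j \<in> {..<?k}" "l \<in> {..<?k}"
      "i \<noteq> j \<and> j \<noteq> l \<and> i \<noteq> l \<and> c (i, j) = 1 \<and> c (j, l) = 1 \<and> c (i, l) = 1"
    then show ?thesis
      using no_c_triangle[of i j l] by simp
  qed (rule bexI)
  then obtain T where T: "T \<in> nsets {..<?k} n" "\<forall>a\<in>T. \<forall>b\<in>T. a \<noteq> b \<longrightarrow> c (a, b) = 0"
    by (elim bexE) (rule that)
  have Tk: "T \<subseteq> {..<?k}" "card T = n" "finite T"
    using T(1) by (auto simp: nsets_def)
  define Q where "Q = \<sigma> ` T"
  have Q: "Q \<subseteq> S" "finite Q" "card Q = n"
    using \<sigma> Tk \<sigma>S card_image[of \<sigma> T] by (auto simp: Q_def bij_betw_def dest: inj_on_subset)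
  have redQ: "\<not> D (x, y)" if "x \<in> Q" "y \<in> Q" for x y
  proof (cases "x = y")
    case True
    then show ?thesis
      using no_D_triangle[of x x x] that Q(1) by auto
  next
    case False
    from that obtain a b where "x = \<sigma> a" "y = \<sigma> b" "a \<in> T" "b \<in> T"
      unfolding Q_def by blast
    then show ?thesis
      using T(2) False by (auto simp: c_def split: if_splits)
  qed
  \<comment> \<open>The tops are listed in increasing order, so that the blocks below them are
    stacked correctly.\<close>
  obtain q where "bij_betw q {..<n} Q" and q_mono: "strict_mono_on {..<n} q"
    using ex_bij_betw_strict_mono_card[OF Q(2)] Q(3) by metis
  then have qQ: "q j \<in> Q" "q j \<in> S" if "j < n" for j
    using that Q(1) by (auto simp: bij_betw_def)
  \<comment> \<open>The sequences below different tops use disjoint index sets, since \<open>D\<close> says nothing about equal indices.\<close>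
  define b where "b j t = v (q j) (t * n + j)" for j t
  have "\<exists>X \<subseteq> {pt M [q j] |j. j < n} \<union> {b j t |j t. j < n}.
    closed_copy ?G X (natLeq *\<^sub>o natLeq_on n +\<^sub>o natLeq_on 1)"
  proof (rule closed_copy_omega_times_plus_one[OF Well_order_gamma_order n_pos])
    fix j assume j: "j < n"
    show "(b j t, b j (Suc t)) \<in> ?G - Id" for t
      unfolding b_def v_def using n_pos by (intro u_less qQ j strict_monoD[OF h(1)]) simp
    show "(b j t, pt M [q j]) \<in> ?G - Id" for t
      unfolding b_def v_def using uP(2,3)[OF qQ(2)[OF j], of "h (t * n + j)"]
        pt_append_less[of M "[q j]"] by auto
    show "\<exists>t. (z, b j t) \<in> ?G - Id" if z: "(z, pt M [q j]) \<in> ?G - Id" for z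
    proof -
      obtain m0 where m0: "\<forall>m\<ge>m0. (z, pt M (u (q j) m)) \<in> ?G - Id"
        using u_lim[OF qQ(2)[OF j] z] by blast
      have "m0 \<le> m0 * n" using n_pos by simp
      also have "\<dots> \<le> m0 * n + j" by simp
      also have "\<dots> \<le> h (m0 * n + j)" by (rule strict_mono_imp_increasing[OF h(1)])
      finally show ?thesis
        using m0 unfolding b_def v_def by blast
    qed
  next
    fix j assume j: "Suc j < n"
    have "q j < q (Suc j)"
      using strict_mono_onD[OF q_mono, of j "Suc j"] j by simp
    moreover obtain a t where "u (q (Suc j)) (h (0 * n + Suc j)) = q (Suc j) # a # t"
      using uP(3)[OF qQ(2)[OF j]] by blast
    moreover from this have "node M (q (Suc j) # a # t)"
      using uP(2)[OF qQ(2)[OF j], of "h (0 * n + Suc j)"] by simp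
    ultimately show "(pt M [q j], b (Suc j) 0) \<in> ?G - Id"
      unfolding b_def v_def
      using pt_less_pt[of M "[]" "q j" "[]" "q (Suc j)" "a # t"] nodeS[OF qQ(2)[of j]] j by simp
  qed
  then obtain X where X: "X \<subseteq> {pt M [q j] |j. j < n} \<union> {b j t |j t. j < n}"
    and copy: "closed_copy ?G X (natLeq *\<^sub>o natLeq_on n +\<^sub>o natLeq_on 1)"
    by blast
  have XF: "X \<subseteq> Field ?G"
    using X qQ v_Field pt_in_Field[OF nodeS] unfolding b_def by blast
  have xb: "\<not> blue (pt M [q i]) (b j t)" if "i < n" "j < n" for i j t
    using uP(1)[OF qQ(2)[OF that(2)]] qQ(2)[OF that(1)] unfolding P_def b_def v_def by blast
  have bb: "\<not> blue (b i t) (b j s)" if "i < n" "j < n" for i j t s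
  proof (cases "t * n + i" "s * n + j" rule: linorder_cases)
    case less
    then show ?thesis
      using D[OF qQ(2) qQ(2) less] redQ[OF qQ(1) qQ(1)] that unfolding b_def by blast
  next
    case equal
    \<comment> \<open>Equal positions have equal residues modulo \<open>n\<close>, so both terms are
      the same point.\<close>
    then have "(t * n + i) mod n = (s * n + j) mod n" by simp
    then have "i = j" using that by simp
    with equal show ?thesis
      using not_blue_self v_Field qQ(2) that unfolding b_def by metis
  next
    case greater
    then show ?thesis
      using D[OF qQ(2) qQ(2) greater] redQ[OF qQ(1) qQ(1)] that blue_sym unfolding b_def by blast
  qed
  obtain x y where xy: "x \<in> X" "y \<in> X" "blue x y"
    using no_red_copy[OF XF copy] by blast
  have xx: "\<not> blue (pt M [q i]) (pt M [q j])" if "i < n" "j < n" for i j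
    using redS qQ(2) that by blast
  have "(\<exists>j<n. z = pt M [q j]) \<or> (\<exists>j<n. \<exists>t. z = b j t)" if "z \<in> X" for z
    using X that by blast
  from this[OF xy(1)] this[OF xy(2)] show False
    using xy(3) blue_sym[OF xy(3)] by (elim disjE exE conjE) (simp_all add: xx xb bb)
qed

end

section \<open>From colourings of pairs to the relation \<open>blue\<close>\<close>

theorem theorem3p2:
  fixes n M :: nat
  assumes "n \<ge> 2"
    and "M = ramsey_number (A3 (ramsey_K_L3 n)) 3"
  shows "(omega_pow_4 *\<^sub>o natLeq_on M +\<^sub>o natLeq_on 1) \<rightarrow>\<^sub>c\<^sub>l
    (natLeq *\<^sub>o natLeq_on n +\<^sub>o natLeq_on 1, natLeq_on 3)\<^sup>2"
  unfolding closed_partition_def gamma_order_def[symmetric]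
proof (intro ballI, rule ccontr)
  let ?G = "gamma_order M"
  fix c assume c: "c \<in> nsets (Field ?G) 2 \<rightarrow> {0, 1::nat}"
  assume none: "\<not> (\<exists>X \<subseteq> Field ?G.
    closed_copy ?G X (natLeq *\<^sub>o natLeq_on n +\<^sub>o natLeq_on 1) \<and> (\<forall>e \<in> nsets X 2. c e = 0) \<or>
    closed_copy ?G X (natLeq_on 3) \<and> (\<forall>e \<in> nsets X 2. c e = 1))"
  have not_red: "\<exists>e \<in> nsets X 2. c e \<noteq> 0"
    if "X \<subseteq> Field ?G" "closed_copy ?G X (natLeq *\<^sub>o natLeq_on n +\<^sub>o natLeq_on 1)" for X
    using none that by blast
  have not_blue: "\<exists>e \<in> nsets X 2. c e \<noteq> 1"
    if "X \<subseteq> Field ?G" "closed_copy ?G X (natLeq_on 3)" for X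
    using none that by blast
  define blue where "blue x y \<longleftrightarrow> x \<noteq> y \<and> c {x, y} = 1" for x y
  obtain F :: "nat filter" where F: "F \<noteq> bot" "F \<le> sequentially"
    and ultra: "\<forall>P. eventually P F \<or> (\<forall>\<^sub>F x in F. \<not> P x)"
    using ex_free_ultrafilter by blast
  \<comment> \<open>A colouring that refutes the partition relation satisfies all assumptions of the
    locale, which excludes the given value of \<open>M\<close>.\<close>
  interpret counterexample n M F blue
  proof
    show "0 < n" using assms(1) by simp
    show "blue y x" if "blue x y" for x y
      using that unfolding blue_def by (metis insert_commute)
    show "eventually P F \<or> (\<forall>\<^sub>F x in F. \<not> P x)" for P
      using ultra by (rule spec)
    show "\<exists>x\<in>X. \<exists>y\<in>X. blue x y"
      if X: "X \<subseteq> Field ?G" "closed_copy ?G X (natLeq *\<^sub>o natLeq_on n +\<^sub>o natLeq_on 1)" for X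
    proof -
      obtain e where e: "e \<in> nsets X 2" "c e \<noteq> 0"
        using not_red[OF X] by blast
      have "e \<in> nsets (Field ?G) 2"
        using nsets_mono[OF X(1)] e(1) by (rule subsetD)
      then have "c e = 1"
        using Pi_mem[OF c, of e] e(2) by simp
      with e(1) show ?thesis
        by (auto simp: blue_def elim!: nsets2_E)
    qed
    show False if xyz: "x \<in> Field ?G" "y \<in> Field ?G" "z \<in> Field ?G"
      and bl: "blue x y" "blue y z" "blue x z" for x y z
    proof -
      have "closed_copy ?G {x, y, z} (natLeq_on 3)"
        using xyz bl by (intro closed_copy_natLeq_on_3 Well_order_gamma_order) (auto simp: blue_def)
      then obtain e where "e \<in> nsets {x, y, z} 2" "c e \<noteq> 1"
        using not_blue[of "{x, y, z}"] xyz by blast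
      then show False
        using bl by (auto simp: blue_def insert_commute elim!: nsets2_E)
    qed
  qed (use F in auto)
  show False
    using M_neq_ramsey_number assms(2) by (rule notE)
qed

end
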